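(* Let $G$ be a graph with the canonical labeling and trivial multiplicity (the classical case). 0) $\operatorname{Aff}(S_n)$ is a point for each $n\in\mathbb{N}$, $n\ge1$. 1) For every multiplicity map $\sigma$ of $G$ (keeping the canonical labeling), $\operatorname{Aff}(G)\cong\operatorname{Aff}(G,\sigma)$ and $I_G=I_{(G,\sigma)}$. Now let $G=(G,l,A,\sigma)$ and $H=(H,i,B,\rho)$ be labelled graphs with multiplicity. 2) $\operatorname{Aff}(G\sqcup H)\cong\operatorname{Aff}(G\#_0H)$. 3) $\phi_{G\sqcup H}=\phi_G\phi_H$, i.e. $\phi_{G\sqcup H}(r_{a\times b})=\phi_G(r_a)\,\phi_H(r_b)$ for every partition $a$ of $V_G$ and every partition $b$ of $V_H$. 4) For every $n\geq 1$, $\operatorname{Aff}(G\sqcup S_n)\cong\operatorname{Aff}(G)$ and $I_{G\sqcup S_n}=I_G'+J$, where $J$ is an ideal generated only by linear relations (linear forms in the variables), and $I_G'$ is the ideal generated by the polynomials obtained from the elements of $I_G$ by replacing each variable $r_{A|B}$ with $r_{A|B\cup V_{S_n}}$. 5) An arbitrary binomial (difference of two monomials) lies in $I_{G\sqcup H}$ if and only if either it is linear of the form $r_{a\times b}-r_{a\times b^*}$ with $a$ a partition of $V_G$ and $b$ a partition of $V_H$, or it is non-linear of the form $$r_{a_1\times b_1}\cdots r_{a_h\times b_h}-r_{a_{h+1}\times b_{h+1}}\cdots r_{a_{2h}\times b_{2h}},$$ where $a_1,\dots,a_{2h}$ are partitions of $V_G$ and $b_1,\dots,b_{2h}$ are partitions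 of $V_H$ with $$r_{a_1}\cdots r_{a_h}-r_{a_{h+1}}\cdots r_{a_{2h}}\in I_{(G,l,A,\sigma)}\quad\text{and}\quad r_{b_1}\cdots r_{b_h}-r_{b_{h+1}}\cdots r_{b_{2h}}\in I_{(H,i,B,\rho)}.$$
   Context: Graphs are finite and simple with nonempty vertex set, $G=(V_G;E_G)$; $\mathbb{K}$ is a field. $S_n$ is the graph with $n$ isolated vertices and no edges. Partitions. For a finite nonempty set $V$, $\Pi_V$ is the set of unordered pairs $A|B$ with $A\cup B=V$, $A\cap B=\emptyset$ (one of $A,B$ may be empty; $A|B=B|A$). $Cut_G(A|B)$ is the set of edges of $G$ with one endpoint in $A$ and the other in $B$. $R_G=\mathbb{K}[r_{p}:p\in\Pi_{V_G}]$. "Partition" always means element of such a $\Pi_V$. Labelled graphs with multiplicity. A labeling is a surjective map $l:E_G\to A$ onto a set $A$ of labels; the canonical labeling is $\{i,j\}\mapsto(i,j)$ (a bijection). A multiplicity map is a map $\sigma:E_G\to\mathbb{Z}\setminus\{0\}$; it is trivial if $\sigma\equiv1$. Then $(G,l,A,\sigma)$ is a labelled graph with multiplicity. The notation $I_G$, $\operatorname{Aff}(G)$ for $G$ in the classical case uses the canonical labeling and trivial multiplicity; $(G,\sigma)$ means $G$ with canonical labeling and multiplicity $\sigma$. Cut ideal and cut variety. Let $T_A=\mathbb{K}[s_a^{\pm1},t_a^{\pm1}:a\in A]$ and let $\phi_{(G,l,A,\sigma)}:R_G\to T_A$ be the $\mathbb{K}$-algebra homomorphism $$r_{p}\mapsto\prod_{e\in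 Cut_G(p)}s_{l(e)}^{\sigma(e)}\prod_{e\in E_G\setminus Cut_G(p)}t_{l(e)}^{\sigma(e)}.$$ The cut ideal $I_{(G,l,A,\sigma)}$ is $\ker\phi_{(G,l,A,\sigma)}$, and the affine cut variety $\operatorname{Aff}(G,l,A,\sigma)$ is the affine variety with coordinate ring $R_G/I_{(G,l,A,\sigma)}$. When the labeling and multiplicity are understood we write $\phi_G,I_G,\operatorname{Aff}(G)$. Operations. The disjoint union is $(G,l,A,\sigma)\sqcup(H,i,B,\rho)=(G\sqcup H,(l,i),A\sqcup B,(\sigma,\rho))$, with disjoint label sets. The clique $0$-sum $G\#_0H$ is the labelled graph with multiplicity obtained from $G\sqcup H$ by identifying one vertex of $G$ with one vertex of $H$ (any choice), edges keeping their labels (in $A\sqcup B$) and multiplicities. Product partitions. Given partitions $a=A|B$ of $V_G$ and $b=C|D$ of $V_H$ written with a chosen order of their parts, $b^*=D|C$, $a\times b=(A\cup C)|(B\cup D)$ and $a\times b^*=(A\cup D)|(B\cup C)$; every partition of $V_G\sqcup V_H$ is of this form. In part 5 the order of the parts in each $a_j$, $b_j$ may be chosen arbitrarily. In part 4, for each partition of $V_G$ one order $A|B$ of its parts is fixed in defining the replacement.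
   Formalization: In part 5 the second family is taken for all h ≥ 1 ("non-linear" is dropped, as it fails e.g. for S_2 ⊔ an edge); if every label has total multiplicity 0 (e.g. no edges), the two monomials may have different numbers h, k of factors, since then r_p − 1 can lie in the ideal. *)

theory Defs
  imports "HOL-Algebra.QuotRing" "HOL-Algebra.Module" "HOL-Library.Poly_Mapping"
begin

section \<open>Labelled graphs with multiplicity\<close>

record ('v, 'l) lmgraph =
  verts :: "'v set"
  edges :: "'v set set"
  lab :: "'v set \<Rightarrow> 'l"
  labels :: "'l set"
  multip :: "'v set \<Rightarrow> int"

definition simple_graph :: "'v set \<Rightarrow> 'v set set \<Rightarrow> bool" where
  "simple_graph V E \<longleftrightarrow> finite V \<and> V \<noteq> {} \<and> (\<forall>e\<in>E. e \<subseteq> V \<and> card e = 2)"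

definition multiplicity_map :: "'v set set \<Rightarrow> ('v set \<Rightarrow> int) \<Rightarrow> bool" where
  "multiplicity_map E \<sigma> \<longleftrightarrow> (\<forall>e\<in>E. \<sigma> e \<noteq> 0)"

definition labelled_multigraph :: "('v, 'l) lmgraph \<Rightarrow> bool" where
  "labelled_multigraph G \<longleftrightarrow>
     simple_graph (verts G) (edges G) \<and> lab G ` edges G = labels G \<and>
     multiplicity_map (edges G) (multip G)"

text \<open>The canonical labeling is bijective; the label of the edge \<open>{i, j}\<close> is taken to be
  the edge itself.\<close>

definition canonical :: "'v set \<Rightarrow> 'v set set \<Rightarrow> ('v set \<Rightarrow> int) \<Rightarrow> ('v, 'v set) lmgraph" where
  "canonical V E \<sigma> = \<lparr>verts = V, edges = E, lab = (\<lambda>e. e), labels = E, multip = \<sigma>\<rparr>"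

definition classical :: "'v set \<Rightarrow> 'v set set \<Rightarrow> ('v, 'v set) lmgraph" where
  "classical V E = canonical V E (\<lambda>_. 1)"

definition isolated :: "nat \<Rightarrow> (nat, nat set) lmgraph" where
  "isolated n = classical {1..n} {}"

definition disjoint_union ::
    "('v, 'l) lmgraph \<Rightarrow> ('w, 'm) lmgraph \<Rightarrow> ('v + 'w, 'l + 'm) lmgraph" where
  "disjoint_union G H =
     \<lparr>verts = verts G <+> verts H,
      edges = (`) Inl ` edges G \<union> (`) Inr ` edges H,
      lab = (\<lambda>e. if e \<subseteq> range Inl then Inl (lab G (Inl -` e)) else Inr (lab H (Inr -` e))),
      labels = labels G <+> labels H,
      multip = (\<lambda>e. if e \<subseteq> range Inl then multip G (Inl -` e) else multip H (Inr -` e))\<rparr>"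

text \<open>The identification of the vertex \<open>y\<close> of the second graph with the vertex \<open>x\<close> of the
  first. The induced map on the edges of the disjoint union is injective, so that every edge of
  the \<open>0\<close>-sum inherits label and multiplicity from a unique edge.\<close>

definition glue :: "'v \<Rightarrow> 'w \<Rightarrow> 'v + 'w \<Rightarrow> 'v + 'w" where
  "glue x y u = (if u = Inr y then Inl x else u)"

definition zero_sum ::
    "'v \<Rightarrow> 'w \<Rightarrow> ('v, 'l) lmgraph \<Rightarrow> ('w, 'm) lmgraph \<Rightarrow> ('v + 'w, 'l + 'm) lmgraph" where
  "zero_sum x y G H =
     (let D = disjoint_union G H;
          lift = inv_into (edges D) ((`) (glue x y))
      in \<lparr>verts = glue x y ` verts D,
          edges = (`) (glue x y) ` edges D,
          lab = (\<lambda>e. lab D (lift e)),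
          labels = labels D,
          multip = (\<lambda>e. multip D (lift e))\<rparr>)"

text \<open>If \<open>d\<close> is the total multiplicity of the label \<open>c\<close>, then in the image of a monomial of
  degree \<open>h\<close> under \<open>cut_map\<close> the exponents of \<open>S c\<close> and \<open>T c\<close> add up to \<open>h * d\<close>. Hence the
  cut ideal is homogeneous as soon as some label has nonzero total multiplicity, for instance in
  the classical case with at least one edge. If all totals vanish, the variable of the partition
  into the whole vertex set and the empty set is mapped to \<open>1\<close>, and the cut ideal is not
  homogeneous.\<close>

definition label_total :: "('v, 'l) lmgraph \<Rightarrow> 'l \<Rightarrow> int" where
  "label_total G c = (\<Sum>e\<in>{e \<in> edges G. lab G e = c}. multip G e)"


section \<open>Partitions\<close>

text \<open>\<open>ordered_partitions V\<close> contains the pairs \<open>(A, B)\<close> that write \<open>A|B\<close> with a chosen order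
  of the parts; \<open>A|B\<close> itself is the set \<open>{A, B}\<close>.\<close>

definition ordered_partitions :: "'v set \<Rightarrow> ('v set \<times> 'v set) set" where
  "ordered_partitions V = {(A, B). A \<union> B = V \<and> A \<inter> B = {}}"

definition unordered :: "'v set \<times> 'v set \<Rightarrow> 'v set set" where
  "unordered a = {fst a, snd a}"

definition partitions :: "'v set \<Rightarrow> 'v set set set" where
  "partitions V = unordered ` ordered_partitions V"

definition cut :: "('v, 'l) lmgraph \<Rightarrow> 'v set set \<Rightarrow> 'v set set" where
  "cut G p = {e \<in> edges G. \<exists>A B x y. p = {A, B} \<and> x \<in> A \<and> y \<in> B \<and> e = {x, y}}"

definition part_prod ::
    "'v set \<times> 'v set \<Rightarrow> 'w set \<times> 'w set \<Rightarrow> ('v + 'w) set set" where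
  "part_prod a b = {Inl ` fst a \<union> Inr ` fst b, Inl ` snd a \<union> Inr ` snd b}"


section \<open>Polynomial and Laurent polynomial rings\<close>

text \<open>A (Laurent) polynomial is a finitely supported function from exponent vectors to
  coefficients, with convolution as product; exponents are natural numbers for
  polynomials and integers for Laurent polynomials.\<close>

datatype 'l tvar = S 'l | T 'l

type_synonym ('x, 'k) polyn = "('x \<Rightarrow>\<^sub>0 nat) \<Rightarrow>\<^sub>0 'k"
type_synonym ('v, 'k) cut_poly = "('v set set, 'k) polyn"
type_synonym ('l, 'k) laurent = "('l tvar \<Rightarrow>\<^sub>0 int) \<Rightarrow>\<^sub>0 'k"

definition const :: "'k \<Rightarrow> 'm::zero \<Rightarrow>\<^sub>0 'k::zero" where
  "const c = Poly_Mapping.single 0 c"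

definition monomial :: "'m \<Rightarrow> 'm \<Rightarrow>\<^sub>0 'k::zero_neq_one" where
  "monomial u = Poly_Mapping.single u 1"

definition var :: "'x \<Rightarrow> ('x, 'k::zero_neq_one) polyn" where
  "var x = monomial (Poly_Mapping.single x 1)"

definition tvar_power :: "'l tvar \<Rightarrow> int \<Rightarrow> ('l, 'k::zero_neq_one) laurent" where
  "tvar_power x k = monomial (Poly_Mapping.single x k)"

text \<open>All (Laurent) polynomials involving only the variables in \<open>X\<close>.\<close>

definition poly_ring :: "'x set \<Rightarrow> (('x \<Rightarrow>\<^sub>0 'e::comm_monoid_add) \<Rightarrow>\<^sub>0 'k::comm_ring_1) ring" where
  "poly_ring X =
     \<lparr>carrier = {f. \<forall>m\<in>Poly_Mapping.keys f. Poly_Mapping.keys m \<subseteq> X},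
      mult = (*), one = 1, zero = 0, add = (+)\<rparr>"

text \<open>The algebra homomorphism that sends each variable \<open>x\<close> to \<open>g x\<close>.\<close>

definition subst_hom ::
    "('x \<Rightarrow> 'm::comm_monoid_add \<Rightarrow>\<^sub>0 'k::comm_ring_1) \<Rightarrow> ('x, 'k) polyn \<Rightarrow> 'm \<Rightarrow>\<^sub>0 'k" where
  "subst_hom g f =
     (\<Sum>m\<in>Poly_Mapping.keys f. const (Poly_Mapping.lookup f m) *
        (\<Prod>x\<in>Poly_Mapping.keys m. g x ^ Poly_Mapping.lookup m x))"

text \<open>The map of Laurent polynomial rings induced by a map of labels.\<close>

definition relabel :: "('l \<Rightarrow> 'm) \<Rightarrow> ('l, 'k::comm_ring_1) laurent \<Rightarrow> ('m, 'k) laurent" where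
  "relabel j f =
     (\<Sum>m\<in>Poly_Mapping.keys f.
        Poly_Mapping.single
          (\<Sum>x\<in>Poly_Mapping.keys m. Poly_Mapping.single (map_tvar j x) (Poly_Mapping.lookup m x))
          (Poly_Mapping.lookup f m))"

definition linear_form :: "('x, 'k::zero) polyn \<Rightarrow> bool" where
  "linear_form f \<longleftrightarrow> (\<forall>m\<in>Poly_Mapping.keys f. \<exists>x. m = Poly_Mapping.single x 1)"

definition binomials :: "'x set \<Rightarrow> ('x, 'k::comm_ring_1) polyn set" where
  "binomials X = {monomial u - monomial v |u v.
     Poly_Mapping.keys u \<subseteq> X \<and> Poly_Mapping.keys v \<subseteq> X}"


section \<open>Cut ideals and cut varieties\<close>

definition cut_ring :: "('v, 'l) lmgraph \<Rightarrow> ('v, 'k::field) cut_poly ring" where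
  "cut_ring G = poly_ring (partitions (verts G))"

definition torus_ring :: "('v, 'l) lmgraph \<Rightarrow> ('l, 'k::field) laurent ring" where
  "torus_ring G = poly_ring (S ` labels G \<union> T ` labels G)"

definition cut_map :: "('v, 'l) lmgraph \<Rightarrow> ('v, 'k::field) cut_poly \<Rightarrow> ('l, 'k) laurent" where
  "cut_map G = subst_hom (\<lambda>p.
     (\<Prod>e\<in>cut G p. tvar_power (S (lab G e)) (multip G e)) *
     (\<Prod>e\<in>edges G - cut G p. tvar_power (T (lab G e)) (multip G e)))"

definition cut_ideal :: "('v, 'l) lmgraph \<Rightarrow> ('v, 'k::field) cut_poly set" where
  "cut_ideal G = a_kernel (cut_ring G) (torus_ring G :: ('l, 'k) laurent ring) (cut_map G)"

text \<open>An affine variety over the field is given by its coordinate ring, as an algebra over the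
  field; isomorphisms of affine varieties are isomorphisms of these algebras, and a point is the
  variety whose coordinate ring is the field itself.\<close>

definition Aff :: "('v, 'l) lmgraph \<Rightarrow> ('k::field, ('v, 'k) cut_poly set) module" where
  "Aff G =
     (let R = cut_ring G; I = cut_ideal G; Q = R Quot I
      in ring.extend Q
           (module.fields (\<lambda>c X. (I +>\<^bsub>R\<^esub> const c) \<otimes>\<^bsub>Q\<^esub> X)))"

definition point :: "('k::field, 'k) module" where
  "point = \<lparr>carrier = UNIV, mult = (*), one = 1, zero = 0, add = (+), smult = (*)\<rparr>"

definition aff_iso :: "('k, 'a) module \<Rightarrow> ('k, 'b) module \<Rightarrow> bool" (infix \<open>\<cong>\<^sub>a\<close> 50) where
  "X \<cong>\<^sub>a Y \<longleftrightarrow>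
     (\<exists>h\<in>ring_iso X Y. \<forall>c. \<forall>f\<in>carrier X. h (c \<odot>\<^bsub>X\<^esub> f) = c \<odot>\<^bsub>Y\<^esub> h f)"

text \<open>For a chosen order \<open>ord p = (A, B)\<close> of the parts of each partition \<open>p\<close>: the replacement of
  \<open>A|B\<close> by \<open>A|(B \<union> W)\<close>, where \<open>W\<close> is the vertex set of the second graph.\<close>

definition extend_vars ::
    "('v set set \<Rightarrow> 'v set \<times> 'v set) \<Rightarrow> 'w set \<Rightarrow>
     ('v, 'k::field) cut_poly \<Rightarrow> ('v + 'w, 'k) cut_poly" where
  "extend_vars ord W = subst_hom (\<lambda>p. var (part_prod (ord p) ({}, W)))"

text \<open>The binomials with \<open>h\<close> factors in the first and \<open>k\<close> factors in the second monomial that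
  arise from pairs of binomials in the two cut ideals.\<close>

definition product_binomial ::
    "('v, 'l) lmgraph \<Rightarrow> ('w, 'm) lmgraph \<Rightarrow> nat \<Rightarrow> nat \<Rightarrow> ('v + 'w, 'k::field) cut_poly \<Rightarrow> bool" where
  "product_binomial G H h k f \<longleftrightarrow>
     (\<exists>a b. (\<forall>j\<in>{1..h + k}. a j \<in> ordered_partitions (verts G) \<and> b j \<in> ordered_partitions (verts H)) \<and>
        f = (\<Prod>j\<in>{1..h}. var (part_prod (a j) (b j))) -
            (\<Prod>j\<in>{h + 1..h + k}. var (part_prod (a j) (b j))) \<and>
        (\<Prod>j\<in>{1..h}. var (unordered (a j))) - (\<Prod>j\<in>{h + 1..h + k}. var (unordered (a j)))
          \<in> (cut_ideal G :: ('v, 'k) cut_poly set) \<and>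
        (\<Prod>j\<in>{1..h}. var (unordered (b j))) - (\<Prod>j\<in>{h + 1..h + k}. var (unordered (b j)))
          \<in> (cut_ideal H :: ('w, 'k) cut_poly set))"

definition swap_binomial ::
    "('v, 'l) lmgraph \<Rightarrow> ('w, 'm) lmgraph \<Rightarrow> ('v + 'w, 'k::field) cut_poly \<Rightarrow> bool" where
  "swap_binomial G H f \<longleftrightarrow>
     (\<exists>a\<in>ordered_partitions (verts G). \<exists>b\<in>ordered_partitions (verts H).
        f = var (part_prod a b) - var (part_prod a (prod.swap b)))"

end

theory Submission
  imports Defs
begin

text \<open>The variable of a partition is mapped to a Laurent monomial, so the cut ideal is the toric ideal
  of the exponent vectors: it depends on them only up to an injective additive map, and the coordinate
  ring only on the set of these vectors. The exponent vector of \<open>a \<times> b\<close> in a disjoint union is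
  the pair of the exponent vectors of \<open>a\<close> and \<open>b\<close>. Hence \<open>a \<times> b\<close> and \<open>a \<times> b\<^sup>*\<close> have the same
  image, isolated vertices contribute nothing, and a binomial lies in the ideal of a disjoint union
  iff both of its projections lie in the ideals of the two graphs. Multiplicities rescale the
  coordinates of the exponent vectors by nonzero factors.\<close>

text \<open>The maps available between sets of partitions need not be bijective: isolated vertices,
  for instance, create partitions that extend no chosen one, so the induced map of polynomial rings
  is onto only modulo the ideal. \<open>aff_iso_subst\<close> therefore asks that
  \<open>\<alpha>\<close> reach every exponent vector, and that an injective additive
  \<open>\<Theta>\<close> match the exponent vectors of the two graphs. Its uses differ in
  \<open>\<Theta>\<close>: coordinatewise multiplication by \<open>\<sigma>\<close> for
  multiplicities, well defined because canonical labels give every edge its own coordinates; the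
  identity for the clique sum, which has the labels of the disjoint union; relabelling by
  \<open>Inl\<close> for isolated vertices. For binomials, membership is an equality of sums of
  exponent vectors, and the numbers of factors on the two sides need an argument of their own: the
  coordinates \<open>S c\<close> and \<open>T c\<close> together count the factors, weighted by the
  total multiplicity of \<open>c\<close>. If all totals vanish, nothing counts them and the two
  degrees can differ; hence the two cases of the statement about binomials.\<close>

abbreviation "keys \<equiv> Poly_Mapping.keys"
abbreviation "lookup \<equiv> Poly_Mapping.lookup"
abbreviation "single \<equiv> Poly_Mapping.single"

section \<open>Finitely supported functions as sums of single terms\<close>

lemma poly_mapping_sum_single: "f = (\<Sum>m\<in>keys f. single m (lookup f m))"
proof (rule poly_mapping_eqI)
  fix k
  have "lookup (\<Sum>m\<in>keys f. single m (lookup f m)) k = (\<Sum>m\<in>keys f. if m = k then lookup f m else 0)"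
    by (auto simp: lookup_sum lookup_single when_def intro!: sum.cong)
  also have "\<dots> = lookup f k"
    by (simp add: in_keys_iff)
  finally show "lookup f k = lookup (\<Sum>m\<in>keys f. single m (lookup f m)) k" by simp
qed

text \<open>Serves at two levels: for polynomials, whose keys are exponent vectors, and for exponent
  vectors, whose keys are variables. The set \<open>M\<close> confines the single terms to those
  over the given keys.\<close>

lemma poly_mapping_induct [consumes 1, case_names zero single add]:
  assumes "keys f \<subseteq> M" and "P 0" and "\<And>m c. m \<in> M \<Longrightarrow> P (single m c)"
    and "\<And>f g. P f \<Longrightarrow> P g \<Longrightarrow> P (f + g)"
  shows "P (f :: 'm \<Rightarrow>\<^sub>0 'c::comm_monoid_add)"
proof -
  have "P (\<Sum>m\<in>K. single m (lookup f m))" if "K \<subseteq> M" "finite K" for K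
    using that(2,1) by (induction K) (auto intro: assms)
  then show ?thesis
    using poly_mapping_sum_single[of f] assms(1) finite_keys[of f] by metis
qed

section \<open>Substitution homomorphisms\<close>

lemma const_add: "const (c + d) = const c + const d"
  by (simp add: const_def single_add)

lemma const_mult: "const (c * d :: 'k::comm_ring_1) = (const c * const d :: 'm::comm_monoid_add \<Rightarrow>\<^sub>0 'k)"
  by (simp add: const_def mult_single)

lemma const_one [simp]: "const (1 :: 'k::comm_ring_1) = (1 :: 'm::comm_monoid_add \<Rightarrow>\<^sub>0 'k)"
  by (simp add: const_def)

lemma const_zero [simp]: "const 0 = 0"
  by (simp add: const_def)

lemma monomial_zero [simp]: "monomial 0 = (1 :: 'm::comm_monoid_add \<Rightarrow>\<^sub>0 'k::comm_ring_1)"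
  by (simp add: monomial_def)

lemma monomial_add:
  "monomial (u + v) = (monomial u * monomial v :: 'm::comm_monoid_add \<Rightarrow>\<^sub>0 'k::comm_ring_1)"
  by (simp add: monomial_def mult_single)

lemma monomial_sum:
  "monomial (\<Sum>j\<in>J. u j) = (\<Prod>j\<in>J. monomial (u j) :: 'm::comm_monoid_add \<Rightarrow>\<^sub>0 'k::comm_ring_1)"
  by (induction J rule: infinite_finite_induct) (simp_all add: monomial_add)

lemma monomial_inject [simp]:
  "(monomial u :: 'm \<Rightarrow>\<^sub>0 'k::zero_neq_one) = monomial v \<longleftrightarrow> u = v"
  by (metis keys_single monomial_def singleton_inject zero_neq_one)

text \<open>The inner product of \<open>subst_hom\<close>, isolated so that its multiplicativity in
  the exponent can be proved separately.\<close>

definition eval_monom :: "('x \<Rightarrow> 'r) \<Rightarrow> ('x \<Rightarrow>\<^sub>0 nat) \<Rightarrow> 'r::comm_monoid_mult" where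
  "eval_monom g m = (\<Prod>x\<in>keys m. g x ^ lookup m x)"

text \<open>Exponents vanish outside \<open>keys m\<close>. The larger index set lets two monomials
  and their product be evaluated over one common set.\<close>

lemma eval_monom_superset:
  assumes "finite K" "keys m \<subseteq> K"
  shows "eval_monom g m = (\<Prod>x\<in>K. g x ^ lookup m x)"
  unfolding eval_monom_def
  by (rule prod.mono_neutral_left) (use assms in \<open>auto simp: in_keys_iff\<close>)

lemma eval_monom_zero [simp]: "eval_monom g 0 = 1"
  by (simp add: eval_monom_def)

lemma eval_monom_single [simp]: "eval_monom g (single x n) = g x ^ n"
  by (cases "n = 0") (simp_all add: eval_monom_def)

lemma eval_monom_add: "eval_monom g (m + n) = eval_monom g m * eval_monom g n"
proof -
  let ?K = "keys m \<union> keys n"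
  have "keys (m + n) \<subseteq> ?K" by (rule keys_add)
  then have "eval_monom g (m + n) = (\<Prod>x\<in>?K. g x ^ lookup (m + n) x)"
    by (intro eval_monom_superset) simp_all
  also have "\<dots> = (\<Prod>x\<in>?K. g x ^ lookup m x) * (\<Prod>x\<in>?K. g x ^ lookup n x)"
    by (simp add: lookup_add power_add prod.distrib)
  also have "\<dots> = eval_monom g m * eval_monom g n"
    by (subst (1 2) eval_monom_superset[of ?K]) simp_all
  finally show ?thesis .
qed

lemma subst_hom_eq_sum:
  "subst_hom g f = (\<Sum>m\<in>keys f. const (lookup f m) * eval_monom g m)"
  by (simp add: subst_hom_def eval_monom_def)

lemma subst_hom_add [simp]: "subst_hom g (f + h) = subst_hom g f + subst_hom g h"
  unfolding subst_hom_eq_sum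
  by (rule setsum_keys_plus_distrib) (simp_all add: const_add distrib_right)

lemma subst_hom_zero [simp]: "subst_hom g 0 = 0"
  by (simp add: subst_hom_def)

lemma subst_hom_single: "subst_hom g (single m c) = const c * eval_monom g m"
  by (cases "c = 0") (simp_all add: subst_hom_eq_sum)

text \<open>Both sides are additive in each factor, so two nested inductions leave only products of
  single terms.\<close>

lemma subst_hom_mult [simp]: "subst_hom g (f * h) = subst_hom g f * subst_hom g h"
proof (induction f rule: poly_mapping_induct[OF subset_UNIV])
  case (2 m c)
  show ?case
  proof (induction h rule: poly_mapping_induct[OF subset_UNIV])
    case (2 n d)
    show ?case
      by (simp add: mult_single subst_hom_single eval_monom_add const_mult mult_ac)
  qed (simp_all add: distrib_left)
qed (simp_all add: distrib_right)

lemma subst_hom_const [simp]: "subst_hom g (const c) = const c"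
  using subst_hom_single[of g 0 c] by (simp add: const_def)

lemma subst_hom_one [simp]: "subst_hom g 1 = 1"
  by (simp flip: const_one)

lemma subst_hom_uminus [simp]: "subst_hom g (- f) = - subst_hom g f"
  by (metis add.right_inverse add_eq_0_iff subst_hom_add subst_hom_zero)

lemma subst_hom_diff [simp]: "subst_hom g (f - h) = subst_hom g f - subst_hom g h"
  by (metis diff_conv_add_uminus subst_hom_add subst_hom_uminus)

lemma subst_hom_prod [simp]: "subst_hom g (\<Prod>j\<in>J. f j) = (\<Prod>j\<in>J. subst_hom g (f j))"
  by (induction J rule: infinite_finite_induct) simp_all

lemma subst_hom_monomial: "subst_hom g (monomial m) = eval_monom g m"
  by (simp add: monomial_def subst_hom_single)

lemma subst_hom_var [simp]: "subst_hom g (var x) = g x"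
  by (simp add: var_def subst_hom_monomial)

section \<open>Polynomial rings\<close>

lemma poly_ring_simps [simp]:
  "mult (poly_ring X) = (*)" "one (poly_ring X) = 1" "zero (poly_ring X) = 0"
  "add (poly_ring X) = (+)"
  by (simp_all add: poly_ring_def)

lemma carrier_poly_ring: "f \<in> carrier (poly_ring X) \<longleftrightarrow> (\<forall>m\<in>keys f. keys m \<subseteq> X)"
  by (simp add: poly_ring_def)

lemma poly_ring_zero [simp]: "0 \<in> carrier (poly_ring X)"
  and poly_ring_one [simp]: "1 \<in> carrier (poly_ring X)"
  by (simp_all add: carrier_poly_ring)

lemma poly_ring_const [simp]: "const c \<in> carrier (poly_ring X)"
  by (cases "c = 0") (simp_all add: carrier_poly_ring const_def)

lemma poly_ring_monomial [simp]:
  "(monomial m :: _ \<Rightarrow>\<^sub>0 'k::comm_ring_1) \<in> carrier (poly_ring X) \<longleftrightarrow> keys m \<subseteq> X"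
  by (simp add: carrier_poly_ring monomial_def)

lemma poly_ring_var [simp]:
  "(var x :: (_, 'k::comm_ring_1) polyn) \<in> carrier (poly_ring X) \<longleftrightarrow> x \<in> X"
  by (simp add: var_def)

lemma poly_ring_add [simp]:
  "f \<in> carrier (poly_ring X) \<Longrightarrow> g \<in> carrier (poly_ring X) \<Longrightarrow> f + g \<in> carrier (poly_ring X)"
  using keys_add[of f g] by (auto simp: carrier_poly_ring)

lemma poly_ring_uminus [simp]:
  "f \<in> carrier (poly_ring X) \<Longrightarrow> - f \<in> carrier (poly_ring X)"
  by (auto simp: carrier_poly_ring in_keys_iff)

lemma poly_ring_diff [simp]:
  "f \<in> carrier (poly_ring X) \<Longrightarrow> g \<in> carrier (poly_ring X) \<Longrightarrow> f - g \<in> carrier (poly_ring X)"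
  by (metis diff_conv_add_uminus poly_ring_add poly_ring_uminus)

lemma poly_ring_mult [simp]:
  assumes "f \<in> carrier (poly_ring X)" "g \<in> carrier (poly_ring X)"
  shows "f * g \<in> carrier (poly_ring X)"
  unfolding carrier_poly_ring
proof
  fix m assume "m \<in> keys (f * g)"
  then obtain u v where "m = u + v" "u \<in> keys f" "v \<in> keys g"
    using keys_mult[of f g] by blast
  then show "keys m \<subseteq> X"
    using assms keys_add[of u v] unfolding carrier_poly_ring by blast
qed

lemma poly_ring_prod [simp]:
  "(\<And>j. j \<in> J \<Longrightarrow> f j \<in> carrier (poly_ring X)) \<Longrightarrow> (\<Prod>j\<in>J. f j) \<in> carrier (poly_ring X)"
  by (induction J rule: infinite_finite_induct) simp_all

lemma poly_ring_cring: "cring (poly_ring X)"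
proof (intro cringI abelian_groupI comm_monoidI)
  fix f :: "('a \<Rightarrow>\<^sub>0 'b) \<Rightarrow>\<^sub>0 'c" assume "f \<in> carrier (poly_ring X)"
  then show "\<exists>g\<in>carrier (poly_ring X). g \<oplus>\<^bsub>poly_ring X\<^esub> f = \<zero>\<^bsub>poly_ring X\<^esub>"
    by (intro bexI[of _ "- f"]) simp_all
qed (simp_all add: algebra_simps)

text \<open>Subtraction in the ring record goes through an inverse within the carrier; uniqueness of
  inverses identifies it with the subtraction of the type class.\<close>

lemma poly_ring_a_minus:
  assumes "f \<in> carrier (poly_ring X)" "g \<in> carrier (poly_ring X)"
  shows "f \<ominus>\<^bsub>poly_ring X\<^esub> g = f - g"
proof -
  interpret cring "poly_ring X" by (rule poly_ring_cring)
  have "\<ominus>\<^bsub>poly_ring X\<^esub> g = - g"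
    using minus_equality[of "- g" g] assms by simp
  then show ?thesis by (simp add: a_minus_def)
qed

lemma var_power: "var x ^ n = (monomial (single x n) :: ('x, 'k::comm_ring_1) polyn)"
  by (induction n) (simp_all add: var_def flip: monomial_add single_add)

text \<open>Expresses a polynomial through its variables. It yields the induction principle below,
  and it lets comparisons of two substitutions cover the case where one of them is the
  identity.\<close>

lemma subst_hom_var_id: "subst_hom var f = f"
proof (induction f rule: poly_mapping_induct[OF subset_UNIV])
  case (2 m c)
  have monomial: "monomial m = (eval_monom var m :: ('a, 'b) polyn)" for m :: "'a \<Rightarrow>\<^sub>0 nat"
  proof (induction m rule: poly_mapping_induct[OF subset_UNIV])
    case (2 x n)
    show ?case by (simp add: var_power)
  qed (simp_all add: monomial_add eval_monom_add)
  show ?case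
    by (simp add: subst_hom_single const_def mult_single monomial_def flip: monomial)
qed simp_all

text \<open>The identity substitution writes \<open>f\<close> as a sum of constants times products
  of variables from \<open>X\<close>. Membership in the carrier is carried along in
  \<open>?Q\<close>, so that the steps for sums and products may use it.\<close>

lemma poly_ring_induct [consumes 1, case_names const var add mult]:
  fixes f :: "('x, 'k::comm_ring_1) polyn"
  assumes "f \<in> carrier (poly_ring X)"
    and const: "\<And>c. P (const c)" and var: "\<And>x. x \<in> X \<Longrightarrow> P (var x)"
    and add: "\<And>f g. f \<in> carrier (poly_ring X) \<Longrightarrow> g \<in> carrier (poly_ring X) \<Longrightarrow> P f \<Longrightarrow> P g \<Longrightarrow> P (f + g)"
    and mult: "\<And>f g. f \<in> carrier (poly_ring X) \<Longrightarrow> g \<in> carrier (poly_ring X) \<Longrightarrow> P f \<Longrightarrow> P g \<Longrightarrow> P (f * g)"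
  shows "P f"
proof -
  let ?Q = "\<lambda>f. f \<in> carrier (poly_ring X) \<and> P f"
  have one: "?Q 1" using const[of 1] by simp
  have pow: "?Q (var x ^ n)" if "x \<in> X" for x n
    by (induction n) (use one var that mult in auto)
  have prod: "?Q (\<Prod>x\<in>K. var x ^ lookup m x)" if "K \<subseteq> X" for K and m :: "'x \<Rightarrow>\<^sub>0 nat"
    using that by (induction K rule: infinite_finite_induct) (use one pow mult in auto)
  have "?Q (\<Sum>m\<in>M. const (lookup f m) * (\<Prod>x\<in>keys m. var x ^ lookup m x))" if "M \<subseteq> keys f" for M
    using that
  proof (induction M rule: infinite_finite_induct)
    case (insert m M)
    then have "?Q (\<Prod>x\<in>keys m. var x ^ lookup m x)"
      using assms(1) by (intro prod) (auto simp: carrier_poly_ring)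
    then show ?case using insert const mult add by auto
  qed (use const[of 0] in simp_all)
  from this[of "keys f"] show ?thesis
    using subst_hom_var_id[of f] by (simp add: subst_hom_def)
qed

lemma subst_hom_closed:
  assumes "f \<in> carrier (poly_ring X)" "\<And>x. x \<in> X \<Longrightarrow> g x \<in> carrier (poly_ring Y)"
  shows "subst_hom g f \<in> carrier (poly_ring Y)"
  using assms(1) by (induction rule: poly_ring_induct) (simp_all add: assms(2))

lemma subst_hom_cong:
  assumes "f \<in> carrier (poly_ring X)" "\<And>x. x \<in> X \<Longrightarrow> g x = h x"
  shows "subst_hom g f = subst_hom h f"
  using assms(1) by (induction rule: poly_ring_induct) (simp_all add: assms(2))

lemma subst_hom_compose: "subst_hom g (subst_hom h f) = subst_hom (\<lambda>x. subst_hom g (h x)) f"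
proof -
  have "f \<in> carrier (poly_ring UNIV)" by (simp add: carrier_poly_ring)
  then show ?thesis by (induction rule: poly_ring_induct) simp_all
qed

section \<open>Change of exponents\<close>

text \<open>The map of monoid algebras induced by a map of exponents; coefficients of exponents with
  the same image add up. \<open>relabel\<close> is an instance.\<close>

definition map_exponents :: "('m \<Rightarrow> 'n) \<Rightarrow> ('m \<Rightarrow>\<^sub>0 'k) \<Rightarrow> ('n \<Rightarrow>\<^sub>0 'k::comm_ring_1)" where
  "map_exponents h f = (\<Sum>m\<in>keys f. single (h m) (lookup f m))"

lemma map_exponents_zero [simp]: "map_exponents h 0 = 0"
  by (simp add: map_exponents_def)

lemma map_exponents_single [simp]: "map_exponents h (single m c) = single (h m) c"
  by (cases "c = 0") (simp_all add: map_exponents_def)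

lemma map_exponents_monomial [simp]: "map_exponents h (monomial m) = monomial (h m)"
  by (simp add: monomial_def)

lemma map_exponents_add [simp]: "map_exponents h (f + g) = map_exponents h f + map_exponents h g"
  unfolding map_exponents_def
  by (rule setsum_keys_plus_distrib) (simp_all add: single_add)

lemma map_exponents_mult:
  assumes "\<And>m n. h (m + n) = h m + h n"
  shows "map_exponents h (f * g) = map_exponents h f * map_exponents h g"
proof (induction f rule: poly_mapping_induct[OF subset_UNIV])
  case (2 m c)
  show ?case
    by (induction g rule: poly_mapping_induct[OF subset_UNIV])
      (simp_all add: mult_single assms distrib_left)
qed (simp_all add: distrib_right)

text \<open>For injective \<open>h\<close> no two exponents merge, so the coefficient of
  \<open>f\<close> at \<open>m\<close> reappears at \<open>h m\<close>.\<close>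

lemma map_exponents_eq_0_iff:
  assumes "inj h"
  shows "map_exponents h f = 0 \<longleftrightarrow> f = 0"
proof
  assume *: "map_exponents h f = 0"
  have "lookup f m = lookup (map_exponents h f) (h m)" for m
  proof -
    have "lookup (map_exponents h f) (h m) = (\<Sum>n\<in>keys f. if n = m then lookup f n else 0)"
      using assms by (auto simp: map_exponents_def lookup_sum lookup_single when_def inj_eq intro!: sum.cong)
    also have "\<dots> = lookup f m" by (simp add: in_keys_iff)
    finally show ?thesis by simp
  qed
  then show "f = 0" using * by (intro poly_mapping_eqI) simp
qed simp

text \<open>For additive \<open>h\<close> the map is an algebra homomorphism, and two homomorphisms
  that agree on constants and variables are equal.\<close>

lemma map_exponents_subst_hom:
  fixes h :: "'m::cancel_comm_monoid_add \<Rightarrow> 'n::cancel_comm_monoid_add"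
    and f :: "('x, 'k::comm_ring_1) polyn"
  assumes "\<And>m n. h (m + n) = h m + h n"
  shows "map_exponents h (subst_hom g f) = subst_hom (\<lambda>x. map_exponents h (g x)) f"
proof -
  \<comment> \<open>Cancellation turns \<open>h 0 = h 0 + h 0\<close> into \<open>h 0 = 0\<close>,
    which is what keeps constants fixed.\<close>
  have "h 0 = 0" using assms[of 0 0] by simp
  have f: "f \<in> carrier (poly_ring UNIV)" by (simp add: carrier_poly_ring)
  show ?thesis
    using f by (induction rule: poly_ring_induct)
      (simp_all add: map_exponents_mult[OF assms] const_def \<open>h 0 = 0\<close>
        subst_hom_single[of _ 0])
qed

text \<open>On polynomials in \<open>X\<close> the substitution \<open>g'\<close> is
  \<open>g\<close> followed by an injective map, so nothing new is sent to zero. All comparisons of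
  cut ideals by a change of exponents rest on this.\<close>

lemma subst_hom_kernel_map_exponents:
  fixes h :: "'m::cancel_comm_monoid_add \<Rightarrow> 'n::cancel_comm_monoid_add"
    and f :: "('x, 'k::comm_ring_1) polyn"
  assumes "\<And>m n. h (m + n) = h m + h n" and "inj h"
    and "f \<in> carrier (poly_ring X)" and "\<And>x. x \<in> X \<Longrightarrow> g' x = map_exponents h (g x)"
  shows "subst_hom g' f = 0 \<longleftrightarrow> subst_hom g f = 0"
proof -
  have "subst_hom g' f = map_exponents h (subst_hom g f)"
    unfolding map_exponents_subst_hom[OF assms(1)] using assms(3,4) by (rule subst_hom_cong)
  then show ?thesis by (simp add: map_exponents_eq_0_iff[OF assms(2)])
qed

section \<open>Cut ideals as toric ideals\<close>

definition edge_var :: "('v, 'l) lmgraph \<Rightarrow> 'v set set \<Rightarrow> 'v set \<Rightarrow> 'l tvar" where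
  "edge_var G p e = (if e \<in> cut G p then S (lab G e) else T (lab G e))"

text \<open>Edges that share a label may contribute to the same coordinate, where their
  multiplicities add up and possibly cancel.\<close>

definition cut_exponent :: "('v, 'l) lmgraph \<Rightarrow> 'v set set \<Rightarrow> 'l tvar \<Rightarrow>\<^sub>0 int" where
  "cut_exponent G p = (\<Sum>e\<in>edges G. single (edge_var G p e) (multip G e))"

lemma finite_edges: "simple_graph V E \<Longrightarrow> finite E"
  unfolding simple_graph_def by (rule finite_subset[of _ "Pow V"]) auto

lemma cut_map_eq_subst_hom:
  assumes "finite (edges G)"
  shows "cut_map G = subst_hom (\<lambda>p. monomial (cut_exponent G p))"
proof -
  have "(\<Prod>e\<in>cut G p. tvar_power (S (lab G e)) (multip G e)) *
      (\<Prod>e\<in>edges G - cut G p. tvar_power (T (lab G e)) (multip G e)) =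
      (monomial (cut_exponent G p) :: ('b, 'c) laurent)" for p
  proof -
    have sub: "cut G p \<subseteq> edges G" by (auto simp: cut_def)
    have "monomial (cut_exponent G p) =
        (\<Prod>e\<in>edges G. monomial (single (edge_var G p e) (multip G e)) :: ('b, 'c) laurent)"
      by (simp add: cut_exponent_def monomial_sum)
    also have "\<dots> = (\<Prod>e\<in>edges G - cut G p. monomial (single (edge_var G p e) (multip G e))) *
        (\<Prod>e\<in>cut G p. monomial (single (edge_var G p e) (multip G e)))"
      using prod.subset_diff[OF sub assms] .
    also have "\<dots> = (\<Prod>e\<in>edges G - cut G p. tvar_power (T (lab G e)) (multip G e)) *
        (\<Prod>e\<in>cut G p. tvar_power (S (lab G e)) (multip G e))"
      by (simp add: edge_var_def tvar_power_def)
    finally show ?thesis by (simp add: mult.commute)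
  qed
  then show ?thesis by (simp add: cut_map_def)
qed

lemma cut_ideal_iff:
  "f \<in> cut_ideal G \<longleftrightarrow> f \<in> carrier (poly_ring (partitions (verts G))) \<and> cut_map G f = 0"
  by (auto simp: cut_ideal_def a_kernel_def' cut_ring_def torus_ring_def)

lemma cut_ideal_ideal: "ideal (cut_ideal G :: ('v, 'k::field) cut_poly set) (cut_ring G)"
proof -
  \<comment> \<open>The target is enlarged to all Laurent polynomials: the kernel depends only on
    the zero of the target, and no value has to be shown to lie in
    \<open>torus_ring G\<close>.\<close>
  let ?P = "poly_ring UNIV :: ('b, 'k) laurent ring"
  interpret cring "cut_ring G :: ('v, 'k) cut_poly ring"
    unfolding cut_ring_def by (rule poly_ring_cring)
  interpret P: cring ?P by (rule poly_ring_cring)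
  have "ring_hom_ring (cut_ring G) ?P (cut_map G)"
    by (intro ring_hom_ringI2 ring_axioms P.ring_axioms ring_hom_memI)
      (simp_all add: cut_ring_def cut_map_def carrier_poly_ring[of _ UNIV])
  moreover have "cut_ideal G = a_kernel (cut_ring G) ?P (cut_map G)"
    by (auto simp: cut_ideal_iff a_kernel_def' cut_ring_def)
  ultimately show ?thesis
    using ring_hom_ring.kernel_is_ideal by metis
qed

section \<open>Coordinate rings and their isomorphisms\<close>

lemma Aff_simps [simp]:
  "carrier (Aff G) = carrier (cut_ring G Quot cut_ideal G)"
  "mult (Aff G) = mult (cut_ring G Quot cut_ideal G)"
  "one (Aff G) = one (cut_ring G Quot cut_ideal G)"
  "zero (Aff G) = zero (cut_ring G Quot cut_ideal G)"
  "add (Aff G) = add (cut_ring G Quot cut_ideal G)"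
  "smult (Aff G) = (\<lambda>c X. (cut_ideal G +>\<^bsub>cut_ring G\<^esub> const c) \<otimes>\<^bsub>cut_ring G Quot cut_ideal G\<^esub> X)"
  by (simp_all add: Aff_def Let_def ring.defs module.defs)

lemma FactRing_carrierE:
  assumes "X \<in> carrier (R Quot I)"
  obtains f where "f \<in> carrier R" "X = I +>\<^bsub>R\<^esub> f"
  using assms by (auto simp: FactRing_def A_RCOSETS_def')

text \<open>The first isomorphism theorem for algebras. The bare ring \<open>R\<close> shares its
  operations with \<open>Y\<close>, so the theorem for rings applies to \<open>R\<close> and is
  carried over; compatibility with scalars is checked on representatives.\<close>

lemma aff_isoI:
  fixes G :: "('v, 'l) lmgraph" and Y :: "('k::field, 'b) module" and R :: "'b ring"
    and h :: "('v, 'k) cut_poly \<Rightarrow> 'b"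
  assumes "ring R" and Y: "carrier Y = carrier R" "mult Y = mult R" "add Y = add R" "one Y = one R"
    and h: "h \<in> ring_hom (cut_ring G) R" and surj: "h ` carrier (cut_ring G) = carrier R"
    and ker: "\<And>f. f \<in> carrier (cut_ring G) \<Longrightarrow> h f = \<zero>\<^bsub>R\<^esub> \<longleftrightarrow> f \<in> cut_ideal G"
    and smult: "\<And>c f. f \<in> carrier (cut_ring G) \<Longrightarrow> h (const c * f) = c \<odot>\<^bsub>Y\<^esub> h f"
  shows "Aff G \<cong>\<^sub>a Y"
proof -
  let ?R = "cut_ring G :: ('v, 'k) cut_poly ring" and ?I = "cut_ideal G :: ('v, 'k) cut_poly set"
  have "cring ?R" unfolding cut_ring_def by (rule poly_ring_cring)
  then have "ring ?R" by (rule cring.axioms)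
  then interpret ring_hom_ring ?R R h
    using assms(1) h by (rule ring_hom_ringI2)
  interpret I: ideal ?I ?R by (rule cut_ideal_ideal)
  \<comment> \<open>\<open>h\<close> is constant on each coset of its kernel, so the image of a
    coset is a singleton and \<open>the_elem\<close> picks the common value.\<close>
  let ?t = "\<lambda>X. the_elem (h ` X)"
  have K: "a_kernel ?R R h = ?I"
    unfolding a_kernel_def' using ker I.Icarr by blast
  have "?t \<in> ring_iso (?R Quot ?I) R"
    using FactRing_iso_set[OF surj] K by simp
  then have "?t \<in> ring_iso (Aff G) Y"
    by (simp add: ring_iso_def ring_hom_def Y)
  moreover have "?t (c \<odot>\<^bsub>Aff G\<^esub> X) = c \<odot>\<^bsub>Y\<^esub> ?t X" if X: "X \<in> carrier (Aff G)" for c X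
  proof -
    obtain f where f: "f \<in> carrier ?R" "X = ?I +>\<^bsub>?R\<^esub> f"
      using X unfolding Aff_simps by (rule FactRing_carrierE)
    have c: "const c \<in> carrier ?R" by (simp add: cut_ring_def)
    have "c \<odot>\<^bsub>Aff G\<^esub> X = ?I +>\<^bsub>?R\<^esub> (const c \<otimes>\<^bsub>?R\<^esub> f)"
      using I.rcoset_mult_add[OF c f(1)] f(2) by (simp add: FactRing_def)
    also have "?t \<dots> = h (const c \<otimes>\<^bsub>?R\<^esub> f)"
      using the_elem_simp[of "const c \<otimes>\<^bsub>?R\<^esub> f"] c f K by simp
    also have "\<dots> = c \<odot>\<^bsub>Y\<^esub> h f" using smult[OF f(1)] by (simp add: cut_ring_def)
    also have "h f = ?t X" using the_elem_simp[OF f(1)] K f(2) by simp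
    finally show ?thesis .
  qed
  ultimately show ?thesis unfolding aff_iso_def by (intro bexI[of _ ?t] ballI allI)
qed

text \<open>Needed for isolated vertices: there the injective change of exponents leads from
  \<open>G\<close> to the disjoint union, while the isomorphism is stated in the other
  direction.\<close>

lemma aff_iso_Aff_sym:
  assumes "(Aff G :: ('k::field, _) module) \<cong>\<^sub>a Y"
  shows "Y \<cong>\<^sub>a Aff G"
proof -
  let ?R = "cut_ring G :: ('a, 'k) cut_poly ring"
  let ?Q = "?R Quot cut_ideal G"
  let ?A = "Aff G :: ('k, ('a, 'k) cut_poly set) module"
  interpret I: ideal "cut_ideal G" ?R by (rule cut_ideal_ideal)
  interpret Q: ring ?Q by (rule I.quotient_is_ring)
  interpret c: ring_hom_ring ?R ?Q "(+>\<^bsub>?R\<^esub>) (cut_ideal G)" by (rule I.rcos_ring_hom_ring)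
  obtain h where h: "h \<in> ring_iso ?A Y"
    and smult: "\<And>c f. f \<in> carrier ?A \<Longrightarrow> h (c \<odot>\<^bsub>?A\<^esub> f) = c \<odot>\<^bsub>Y\<^esub> h f"
    using assms unfolding aff_iso_def by (elim bexE) simp
  have bij: "bij_betw h (carrier ?A) (carrier Y)" using h by (simp add: ring_iso_def)
  let ?g = "inv_into (carrier ?A) h"
  have "h \<in> ring_iso ?Q Y" using h by (simp add: ring_iso_def ring_hom_def)
  then have "?g \<in> ring_iso Y ?Q" using ring_iso_set_sym[OF Q.ring_axioms] by simp
  then have "?g \<in> ring_iso Y ?A" by (simp add: ring_iso_def ring_hom_def)
  moreover have "?g (c \<odot>\<^bsub>Y\<^esub> y) = c \<odot>\<^bsub>?A\<^esub> ?g y" if y: "y \<in> carrier Y" for c y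
  proof -
    have gy: "?g y \<in> carrier ?A" "h (?g y) = y"
      using bij y by (simp_all add: bij_betw_def inv_into_into f_inv_into_f)
    have "const c \<in> carrier ?R" by (simp add: cut_ring_def)
    then have closed: "c \<odot>\<^bsub>?A\<^esub> ?g y \<in> carrier ?A"
      using gy(1) c.hom_closed by simp
    have "c \<odot>\<^bsub>Y\<^esub> y = h (c \<odot>\<^bsub>?A\<^esub> ?g y)" using smult[OF gy(1)] gy(2) by simp
    then show ?thesis
      using inv_into_f_f[OF bij_betw_imp_inj_on[OF bij] closed] by simp
  qed
  ultimately show ?thesis unfolding aff_iso_def by (intro bexI[of _ ?g] ballI allI)
qed

text \<open>Both sides carry a substitution so that either one can be the identity:
  \<open>\<alpha> = id\<close> compares along an extension of partitions,
  \<open>\<beta> = id\<close> along a restriction.\<close>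

lemma cut_map_subst_kernel:
  fixes f :: "('v, 'k::field) cut_poly"
  assumes fin: "finite (edges G)" "finite (edges H)"
    and f: "f \<in> carrier (poly_ring X)"
    and add: "\<And>m n. \<Theta> (m + n) = \<Theta> m + \<Theta> n" and "inj \<Theta>"
    and exp: "\<And>p. p \<in> X \<Longrightarrow> cut_exponent H (\<beta> p) = \<Theta> (cut_exponent G (\<alpha> p))"
  shows "cut_map H (subst_hom (\<lambda>p. var (\<beta> p)) f) = (0 :: ('m, 'k) laurent) \<longleftrightarrow>
    cut_map G (subst_hom (\<lambda>p. var (\<alpha> p)) f) = (0 :: ('l, 'k) laurent)"
  unfolding cut_map_eq_subst_hom[OF fin(1)] cut_map_eq_subst_hom[OF fin(2)]
    subst_hom_compose subst_hom_var
  by (rule subst_hom_kernel_map_exponents[OF add \<open>inj \<Theta>\<close> f]) (simp add: exp)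

text \<open>The isomorphism is induced by substitution followed by projection to the quotient.
  Variables with equal exponent vectors are congruent modulo the cut ideal, so it is onto as soon as
  \<open>\<alpha>\<close> reaches every exponent vector; its kernel is the cut ideal of
  \<open>G\<close> because \<open>\<Theta>\<close> is injective.\<close>

lemma aff_iso_subst:
  fixes G :: "('v, 'l) lmgraph" and H :: "('w, 'm) lmgraph"
  assumes fin: "finite (edges G)" "finite (edges H)"
    and \<alpha>: "\<And>p. p \<in> partitions (verts G) \<Longrightarrow> \<alpha> p \<in> partitions (verts H)"
    and surj: "\<And>q. q \<in> partitions (verts H) \<Longrightarrow>
      \<exists>p\<in>partitions (verts G). cut_exponent H (\<alpha> p) = cut_exponent H q"
    and add: "\<And>m n. \<Theta> (m + n) = \<Theta> m + \<Theta> n" and "inj \<Theta>"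
    and exp: "\<And>p. p \<in> partitions (verts G) \<Longrightarrow> cut_exponent H (\<alpha> p) = \<Theta> (cut_exponent G p)"
  shows "(Aff G :: ('k::field, _) module) \<cong>\<^sub>a Aff H"
proof -
  let ?R = "cut_ring H :: ('w, 'k) cut_poly ring" and ?I = "cut_ideal H :: ('w, 'k) cut_poly set"
  let ?s = "subst_hom (\<lambda>p. var (\<alpha> p)) :: ('v, 'k) cut_poly \<Rightarrow> ('w, 'k) cut_poly"
  let ?h = "\<lambda>f. ?I +>\<^bsub>?R\<^esub> ?s f"
  interpret R: cring ?R unfolding cut_ring_def by (rule poly_ring_cring)
  interpret I: ideal ?I ?R by (rule cut_ideal_ideal)
  interpret Q: ring "?R Quot ?I" by (rule I.quotient_is_ring)
  interpret c: ring_hom_ring ?R "?R Quot ?I" "(+>\<^bsub>?R\<^esub>) ?I" by (rule I.rcos_ring_hom_ring)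
  have s: "?s f \<in> carrier ?R" if "f \<in> carrier (cut_ring G)" for f
    using that unfolding cut_ring_def by (rule subst_hom_closed) (simp add: \<alpha>)
  have h: "?h \<in> ring_hom (cut_ring G) (?R Quot ?I)"
  proof (rule ring_hom_memI)
    fix f g :: "('v, 'k) cut_poly"
    assume fg: "f \<in> carrier (cut_ring G)" "g \<in> carrier (cut_ring G)"
    show "?h f \<in> carrier (?R Quot ?I)" by (rule c.hom_closed[OF s[OF fg(1)]])
    show "?h (f \<otimes>\<^bsub>cut_ring G\<^esub> g) = ?h f \<otimes>\<^bsub>?R Quot ?I\<^esub> ?h g"
      using c.hom_mult[OF s[OF fg(1)] s[OF fg(2)]] by (simp add: cut_ring_def)
    show "?h (f \<oplus>\<^bsub>cut_ring G\<^esub> g) = ?h f \<oplus>\<^bsub>?R Quot ?I\<^esub> ?h g"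
      using c.hom_add[OF s[OF fg(1)] s[OF fg(2)]] by (simp add: cut_ring_def)
  next
    show "?h \<one>\<^bsub>cut_ring G\<^esub> = \<one>\<^bsub>?R Quot ?I\<^esub>"
      using c.hom_one by (simp add: cut_ring_def)
  qed
  \<comment> \<open>\<open>\<beta>\<close> inverts \<open>\<alpha>\<close> up to equality of
    exponent vectors, so substituting back and forth changes a polynomial only by an element of the
    ideal.\<close>
  obtain \<beta> where \<beta>: "\<And>q. q \<in> partitions (verts H) \<Longrightarrow> \<beta> q \<in> partitions (verts G)"
      "\<And>q. q \<in> partitions (verts H) \<Longrightarrow> cut_exponent H (\<alpha> (\<beta> q)) = cut_exponent H q"
    using surj by metis
  have onto: "?h ` carrier (cut_ring G) = carrier (?R Quot ?I)"
  proof (intro equalityI subsetI)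
    fix X assume "X \<in> carrier (?R Quot ?I)"
    then obtain g where g: "g \<in> carrier ?R" "X = ?I +>\<^bsub>?R\<^esub> g"
      by (rule FactRing_carrierE)
    let ?f = "subst_hom (\<lambda>q. var (\<beta> q)) g :: ('v, 'k) cut_poly"
    have f: "?f \<in> carrier (cut_ring G)"
      using g(1) unfolding cut_ring_def by (rule subst_hom_closed) (simp add: \<beta>)
    have "cut_map H (?s ?f) = (cut_map H g :: ('m, 'k) laurent)"
      unfolding cut_map_eq_subst_hom[OF fin(2)] subst_hom_compose subst_hom_var
      using g(1) unfolding cut_ring_def by (rule subst_hom_cong) (simp add: \<beta>)
    then have "?s ?f - g \<in> ?I"
      using s[OF f] g(1) by (simp add: cut_ideal_iff cut_ring_def cut_map_def)
    then have "?s ?f \<ominus>\<^bsub>?R\<^esub> g \<in> ?I"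
      using s[OF f] g(1) by (simp add: cut_ring_def poly_ring_a_minus)
    then have "X = ?h ?f"
      using R.quotient_eq_iff_same_a_r_cos[OF I.ideal_axioms s[OF f] g(1)] g(2) by simp
    then show "X \<in> ?h ` carrier (cut_ring G)" using f by blast
  next
    fix X assume "X \<in> ?h ` carrier (cut_ring G)"
    then obtain f where "f \<in> carrier (cut_ring G)" "X = ?h f" by (rule imageE)
    then show "X \<in> carrier (?R Quot ?I)" using ring_hom_closed[OF h] by (simp only:)
  qed
  have zero: "\<zero>\<^bsub>?R Quot ?I\<^esub> = ?I"
    unfolding FactRing_def ring_record_simps by (rule refl)
  have ker: "?h f = \<zero>\<^bsub>?R Quot ?I\<^esub> \<longleftrightarrow> f \<in> cut_ideal G" if f: "f \<in> carrier (cut_ring G)" for f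
  proof -
    have "?h f = \<zero>\<^bsub>?R Quot ?I\<^esub> \<longleftrightarrow> ?s f \<in> ?I"
      unfolding zero using I.rcos_const_imp_mem[OF s[OF f]] I.a_rcos_const[of "?s f"] by metis
    also have "\<dots> \<longleftrightarrow> cut_map H (?s f) = (0 :: ('m, 'k) laurent)"
      using s[OF f] by (simp add: cut_ideal_iff cut_ring_def)
    also have "\<dots> \<longleftrightarrow> cut_map G f = (0 :: ('l, 'k) laurent)"
      using cut_map_subst_kernel[OF fin f[unfolded cut_ring_def] add \<open>inj \<Theta>\<close>, of \<alpha> id] exp
      by (simp add: subst_hom_var_id)
    also have "\<dots> \<longleftrightarrow> f \<in> cut_ideal G"
      using f by (simp add: cut_ideal_iff cut_ring_def)
    finally show ?thesis .
  qed
  have smult: "?h (const c * f) = c \<odot>\<^bsub>Aff H\<^esub> ?h f" if f: "f \<in> carrier (cut_ring G)" for c f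
  proof -
    have "const c \<in> carrier ?R" by (simp add: cut_ring_def)
    from c.hom_mult[OF this s[OF f]] show ?thesis by (simp add: cut_ring_def)
  qed
  show ?thesis
    by (rule aff_isoI[OF I.quotient_is_ring Aff_simps(1,2,5,3) h onto ker smult])
qed

section \<open>Relabelling\<close>

text \<open>The action of \<open>relabel\<close> on a single exponent vector.\<close>

definition map_tvars :: "('l \<Rightarrow> 'm) \<Rightarrow> ('l tvar \<Rightarrow>\<^sub>0 int) \<Rightarrow> ('m tvar \<Rightarrow>\<^sub>0 int)" where
  "map_tvars j m = (\<Sum>x\<in>keys m. single (map_tvar j x) (lookup m x))"

lemma relabel_eq_map_exponents: "relabel j = map_exponents (map_tvars j)"
  by (simp add: fun_eq_iff relabel_def map_exponents_def map_tvars_def)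

lemma map_tvars_zero [simp]: "map_tvars j 0 = 0"
  by (simp add: map_tvars_def)

lemma map_tvars_single [simp]: "map_tvars j (single x k) = single (map_tvar j x) k"
  by (cases "k = 0") (simp_all add: map_tvars_def)

lemma map_tvars_add: "map_tvars j (m + n) = map_tvars j m + map_tvars j n"
  unfolding map_tvars_def by (rule setsum_keys_plus_distrib) (simp_all add: single_add)

lemma map_tvars_sum: "map_tvars j (\<Sum>i\<in>I. m i) = (\<Sum>i\<in>I. map_tvars j (m i))"
  by (induction I rule: infinite_finite_induct) (simp_all add: map_tvars_add)

lemma lookup_map_tvars:
  assumes "inj j"
  shows "lookup (map_tvars j m) (map_tvar j x) = lookup m x"
proof -
  have "lookup (map_tvars j m) (map_tvar j x) = (\<Sum>y\<in>keys m. if y = x then lookup m y else 0)"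
    using tvar.inj_map[OF assms]
    by (simp add: map_tvars_def lookup_sum lookup_single when_def inj_eq)
  then show ?thesis by (simp add: in_keys_iff)
qed

lemma lookup_map_tvars_notin:
  assumes "x \<notin> range (map_tvar j)"
  shows "lookup (map_tvars j m) x = 0"
  using assms by (auto simp: map_tvars_def lookup_sum lookup_single when_def intro!: sum.neutral)

lemma inj_map_tvars: "inj j \<Longrightarrow> inj (map_tvars j)"
  by (rule injI, rule poly_mapping_eqI) (metis lookup_map_tvars)

text \<open>The coordinates of left and right labels are disjoint, so each summand can be read off
  the sum. This is what splits one equation for a disjoint union into one for each graph.\<close>

lemma map_tvars_Inl_Inr_eq_iff:
  "map_tvars Inl m + map_tvars Inr n = map_tvars Inl m' + map_tvars Inr n' \<longleftrightarrow> m = m' \<and> n = n'"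
  (is "?l = ?r \<longleftrightarrow> _")
proof
  assume eq: "?l = ?r"
  have "map_tvar Inl x \<noteq> map_tvar Inr y" for x y
    by (cases x; cases y) auto
  then have notin: "map_tvar Inl x \<notin> range (map_tvar Inr)" "map_tvar Inr y \<notin> range (map_tvar Inl)" for x y
    by (metis imageE)+
  have "lookup m x = lookup m' x" for x
    using arg_cong[OF eq, of "\<lambda>f. lookup f (map_tvar Inl x)"]
    by (simp add: lookup_add lookup_map_tvars lookup_map_tvars_notin notin)
  moreover have "lookup n x = lookup n' x" for x
    using arg_cong[OF eq, of "\<lambda>f. lookup f (map_tvar Inr x)"]
    by (simp add: lookup_add lookup_map_tvars lookup_map_tvars_notin notin)
  ultimately show "m = m' \<and> n = n'" by (auto intro: poly_mapping_eqI)
qed simp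

section \<open>Partitions and cuts\<close>

lemma ordered_partitions_iff: "a \<in> ordered_partitions V \<longleftrightarrow> fst a \<union> snd a = V \<and> fst a \<inter> snd a = {}"
  by (cases a) (simp add: ordered_partitions_def)

lemma unordered_swap [simp]: "unordered (prod.swap a) = unordered a"
  by (auto simp: unordered_def)

lemma swap_ordered_partitions [simp]:
  "prod.swap a \<in> ordered_partitions V \<longleftrightarrow> a \<in> ordered_partitions V"
  by (cases a) (auto simp: ordered_partitions_def)

lemma unordered_partitions [simp]: "a \<in> ordered_partitions V \<Longrightarrow> unordered a \<in> partitions V"
  by (simp add: partitions_def)

lemma trivial_ordered_partition [simp]: "({}, V) \<in> ordered_partitions V"
  by (simp add: ordered_partitions_def)

text \<open>Replaces the existential definition of \<open>cut\<close> by a test that transfers along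
  images and preimages of vertices. Endpoints picked in the two parts differ since the parts are
  disjoint, so they exhaust the two-element edge.\<close>

lemma cut_unordered:
  assumes e: "e \<in> edges G" "card e = 2" and a: "fst a \<inter> snd a = {}" "e \<subseteq> fst a \<union> snd a"
  shows "e \<in> cut G (unordered a) \<longleftrightarrow> e \<inter> fst a \<noteq> {} \<and> e \<inter> snd a \<noteq> {}"
proof
  assume "e \<in> cut G (unordered a)"
  then show "e \<inter> fst a \<noteq> {} \<and> e \<inter> snd a \<noteq> {}"
    by (fastforce simp: cut_def unordered_def doubleton_eq_iff)
next
  assume *: "e \<inter> fst a \<noteq> {} \<and> e \<inter> snd a \<noteq> {}"
  then obtain x y where xy: "x \<in> e" "x \<in> fst a" "y \<in> e" "y \<in> snd a" by blast
  then have "x \<noteq> y" using a by blast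
  have "e = {x, y}"
    by (rule sym, rule card_subset_eq)
      (use e xy \<open>x \<noteq> y\<close> in \<open>auto simp: card_eq_0_iff intro: card_ge_0_finite\<close>)
  then show "e \<in> cut G (unordered a)"
    using xy e unfolding cut_def unordered_def by blast
qed

lemma cut_unordered_simple:
  assumes "simple_graph (verts G) (edges G)" "a \<in> ordered_partitions (verts G)" "e \<in> edges G"
  shows "e \<in> cut G (unordered a) \<longleftrightarrow> e \<inter> fst a \<noteq> {} \<and> e \<inter> snd a \<noteq> {}"
proof (rule cut_unordered)
  show "fst a \<inter> snd a = {}"
    using assms(2) by (auto simp: ordered_partitions_def)
  have "fst a \<union> snd a = verts G"
    using assms(2) by (auto simp: ordered_partitions_def)
  then show "e \<subseteq> fst a \<union> snd a"
    using assms(1,3) by (simp add: simple_graph_def)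
qed (use assms in \<open>simp_all add: simple_graph_def\<close>)

lemma cut_exponent_edgeless [simp]: "edges G = {} \<Longrightarrow> cut_exponent G p = 0"
  by (simp add: cut_exponent_def)

lemma edge_nonempty: "simple_graph V E \<Longrightarrow> e \<in> E \<Longrightarrow> e \<noteq> {}"
  by (auto simp: simple_graph_def)

lemma map_tvar_edge_var:
  "map_tvar j (edge_var G p e) = (if e \<in> cut G p then S (j (lab G e)) else T (j (lab G e)))"
  by (simp add: edge_var_def)

section \<open>Disjoint unions\<close>

lemma disjoint_union_simps [simp]:
  "verts (disjoint_union G H) = verts G <+> verts H"
  "edges (disjoint_union G H) = (`) Inl ` edges G \<union> (`) Inr ` edges H"
  by (simp_all add: disjoint_union_def)

lemma disjoint_union_Inl [simp]:
  "lab (disjoint_union G H) (Inl ` e) = Inl (lab G e)"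
  "multip (disjoint_union G H) (Inl ` e) = multip G e"
  by (simp_all add: disjoint_union_def image_subset_iff inj_vimage_image_eq)

text \<open>The side of an edge is decided by inclusion in \<open>range Inl\<close>, which the empty
  set satisfies as well; a nonempty right edge cannot be mistaken for a left one.\<close>

lemma disjoint_union_Inr:
  fixes G :: "('v, 'l) lmgraph" and H :: "('w, 'm) lmgraph"
  assumes "e \<noteq> {}"
  shows "lab (disjoint_union G H) (Inr ` e) = Inr (lab H e)"
    "multip (disjoint_union G H) (Inr ` e) = multip H e"
proof -
  have "\<not> (Inr ` e :: ('v + 'w) set) \<subseteq> range Inl" using assms by auto
  then show "lab (disjoint_union G H) (Inr ` e) = Inr (lab H e)"
    "multip (disjoint_union G H) (Inr ` e) = multip H e"
    by (simp_all add: disjoint_union_def inj_vimage_image_eq)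
qed

lemma simple_graph_disjoint_union:
  assumes "simple_graph (verts G) (edges G)" "simple_graph (verts H) (edges H)"
  shows "simple_graph (verts (disjoint_union G H)) (edges (disjoint_union G H))"
  using assms by (auto simp: simple_graph_def card_image)

text \<open>The product partition with the order of its parts kept, the form in which the
  intersection test for cuts applies.\<close>

definition ordered_prod ::
    "'v set \<times> 'v set \<Rightarrow> 'w set \<times> 'w set \<Rightarrow> ('v + 'w) set \<times> ('v + 'w) set" where
  "ordered_prod a b = (fst a <+> fst b, snd a <+> snd b)"

lemma part_prod_eq_unordered: "part_prod a b = unordered (ordered_prod a b)"
  by (simp add: part_prod_def unordered_def ordered_prod_def Plus_def)

lemma ordered_prod_partition [simp]:
  assumes "a \<in> ordered_partitions V" "b \<in> ordered_partitions W"
  shows "ordered_prod a b \<in> ordered_partitions (V <+> W)"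
  using assms by (auto simp: ordered_prod_def ordered_partitions_def)

lemma part_prod_partition [simp]:
  assumes "a \<in> ordered_partitions V" "b \<in> ordered_partitions W"
  shows "part_prod a b \<in> partitions (V <+> W)"
  using assms by (simp add: part_prod_eq_unordered)

text \<open>Any order \<open>(A, B)\<close> of the parts is fixed, and the traces of
  \<open>A\<close> and \<open>B\<close> on the two sides are taken in this same order.\<close>

lemma partition_Plus_cases:
  assumes "p \<in> partitions (V <+> W)"
  obtains a b where "a \<in> ordered_partitions V" "b \<in> ordered_partitions W" "p = part_prod a b"
proof -
  obtain A B where p: "p = {A, B}" and AB: "A \<union> B = V <+> W" "A \<inter> B = {}"
    using assms by (auto simp: partitions_def ordered_partitions_def unordered_def)
  have split: "Inl ` (Inl -` C) \<union> Inr ` (Inr -` C) = C" for C :: "('a + 'b) set"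
  proof (rule Set.set_eqI)
    fix x show "x \<in> Inl ` (Inl -` C) \<union> Inr ` (Inr -` C) \<longleftrightarrow> x \<in> C" by (cases x) auto
  qed
  show ?thesis
  proof
    show "(Inl -` A, Inl -` B) \<in> ordered_partitions V"
      using AB by (auto simp: ordered_partitions_def)
    show "(Inr -` A, Inr -` B) \<in> ordered_partitions W"
      using AB by (auto simp: ordered_partitions_def)
    show "p = part_prod (Inl -` A, Inl -` B) (Inr -` A, Inr -` B)"
      unfolding part_prod_def fst_conv snd_conv split by (rule p)
  qed
qed

context
  fixes G :: "('v, 'l) lmgraph" and H :: "('w, 'm) lmgraph"
  assumes G: "simple_graph (verts G) (edges G)" and H: "simple_graph (verts H) (edges H)"
begin

lemma Inl_edge_cut:
  assumes "a \<in> ordered_partitions (verts G)" "b \<in> ordered_partitions (verts H)" "e \<in> edges G"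
  shows "Inl ` e \<in> cut (disjoint_union G H) (part_prod a b) \<longleftrightarrow> e \<in> cut G (unordered a)"
proof -
  have "Inl ` e \<inter> (A <+> B) = Inl ` (e \<inter> A)" for A :: "'v set" and B :: "'w set"
    by auto
  then have "Inl ` e \<in> cut (disjoint_union G H) (unordered (ordered_prod a b)) \<longleftrightarrow>
      e \<inter> fst a \<noteq> {} \<and> e \<inter> snd a \<noteq> {}"
    using assms by (subst cut_unordered_simple[OF simple_graph_disjoint_union[OF G H]])
      (simp_all, simp add: ordered_prod_def)
  then show ?thesis
    using assms by (simp add: part_prod_eq_unordered cut_unordered_simple G)
qed

lemma Inr_edge_cut:
  assumes "a \<in> ordered_partitions (verts G)" "b \<in> ordered_partitions (verts H)" "e \<in> edges H"
  shows "Inr ` e \<in> cut (disjoint_union G H) (part_prod a b) \<longleftrightarrow> e \<in> cut H (unordered b)"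
proof -
  have "Inr ` e \<inter> (A <+> B) = Inr ` (e \<inter> B)" for A :: "'v set" and B :: "'w set"
    by auto
  then have "Inr ` e \<in> cut (disjoint_union G H) (unordered (ordered_prod a b)) \<longleftrightarrow>
      e \<inter> fst b \<noteq> {} \<and> e \<inter> snd b \<noteq> {}"
    using assms by (subst cut_unordered_simple[OF simple_graph_disjoint_union[OF G H]])
      (simp_all, simp add: ordered_prod_def)
  then show ?thesis
    using assms by (simp add: part_prod_eq_unordered cut_unordered_simple H)
qed

text \<open>No edge joins the two sides, so the sum over edges splits, and an edge of one graph
  meets only the components of the product parts on its own side.\<close>

lemma cut_exponent_disjoint_union:
  assumes a: "a \<in> ordered_partitions (verts G)" and b: "b \<in> ordered_partitions (verts H)"
  shows "cut_exponent (disjoint_union G H) (part_prod a b) =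
    map_tvars Inl (cut_exponent G (unordered a)) + map_tvars Inr (cut_exponent H (unordered b))"
proof -
  let ?D = "disjoint_union G H"
  let ?t = "\<lambda>e. single (edge_var ?D (part_prod a b) e) (multip ?D e)"
  \<comment> \<open>The two embeddings agree on the empty set, so disjointness of the edge families
    relies on edges being nonempty.\<close>
  have "Inl ` d \<noteq> (Inr ` e :: ('v + 'w) set)" if "e \<in> edges H" for d e
    using edge_nonempty[OF H that] by auto
  then have disj: "(`) Inl ` edges G \<inter> (`) Inr ` edges H = {}"
    by (auto simp: disjoint_iff)
  have "cut_exponent ?D (part_prod a b) =
      (\<Sum>e\<in>(`) Inl ` edges G. ?t e) + (\<Sum>e\<in>(`) Inr ` edges H. ?t e)"
    unfolding cut_exponent_def disjoint_union_simps
    by (rule sum.union_disjoint) (simp_all add: disj finite_edges[OF G] finite_edges[OF H])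
  also have "(\<Sum>e\<in>(`) Inl ` edges G. ?t e) = (\<Sum>e\<in>edges G. ?t (Inl ` e))"
    by (subst sum.reindex) (auto simp: inj_on_def inj_image_eq_iff)
  also have "\<dots> = map_tvars Inl (cut_exponent G (unordered a))"
    unfolding cut_exponent_def map_tvars_sum map_tvars_single map_tvar_edge_var
    by (rule sum.cong[OF refl])
      (simp add: edge_var_def Inl_edge_cut[OF a b])
  also have "(\<Sum>e\<in>(`) Inr ` edges H. ?t e) = (\<Sum>e\<in>edges H. ?t (Inr ` e))"
    by (subst sum.reindex) (auto simp: inj_on_def inj_image_eq_iff)
  also have "\<dots> = map_tvars Inr (cut_exponent H (unordered b))"
    unfolding cut_exponent_def map_tvars_sum map_tvars_single map_tvar_edge_var
    by (rule sum.cong[OF refl])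
      (simp add: edge_var_def Inr_edge_cut[OF a b] disjoint_union_Inr[OF edge_nonempty[OF H]])
  finally show ?thesis .
qed

text \<open>The factors live in Laurent rings over different labels; \<open>relabel\<close> moves
  both to the common ring, where adding exponents is multiplying monomials.\<close>

lemma cut_map_disjoint_union:
  assumes "a \<in> ordered_partitions (verts G)" "b \<in> ordered_partitions (verts H)"
  shows "(cut_map (disjoint_union G H) (var (part_prod a b)) :: ('l + 'm, 'k::field) laurent) =
    relabel Inl (cut_map G (var (unordered a))) * relabel Inr (cut_map H (var (unordered b)))"
  using cut_exponent_disjoint_union[OF assms] finite_edges[OF G] finite_edges[OF H]
  by (simp add: cut_map_eq_subst_hom relabel_eq_map_exponents monomial_add)

end

section \<open>Edgeless graphs and multiplicities\<close>

lemma Aff_edgeless: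
  assumes "edges G = {}"
  shows "(Aff G :: ('k::field, ('v, 'k) cut_poly set) module) \<cong>\<^sub>a point"
proof -
  let ?K = "\<lparr>carrier = UNIV, mult = (*), one = 1, zero = 0, add = (+)\<rparr> :: 'k ring"
  let ?\<phi> = "cut_map G :: ('v, 'k) cut_poly \<Rightarrow> ('a, 'k) laurent"
  \<comment> \<open>Without edges every variable goes to \<open>1\<close>, so \<open>cut_map\<close>
    takes only constant values; \<open>?h\<close> reads off the constant.\<close>
  let ?h = "\<lambda>f. lookup (?\<phi> f) 0"
  have "ring ?K"
  proof (intro ringI abelian_groupI monoidI)
    fix x :: 'k
    show "\<exists>y\<in>carrier ?K. y \<oplus>\<^bsub>?K\<^esub> x = \<zero>\<^bsub>?K\<^esub>"
      by (rule bexI[of _ "- x"]) simp_all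
  qed (simp_all add: algebra_simps)
  have \<phi>: "?\<phi> = subst_hom (\<lambda>_. 1)"
    using assms by (simp add: cut_map_eq_subst_hom)
  have const: "?\<phi> f = const (?h f)" for f
  proof -
    have "f \<in> carrier (poly_ring UNIV)" by (simp add: carrier_poly_ring)
    then have "\<exists>c. ?\<phi> f = const c"
      unfolding \<phi> by (induction rule: poly_ring_induct) (auto simp flip: const_add const_mult const_one)
    then show ?thesis by (auto simp: const_def)
  qed
  have h_const: "?h (const c) = c" for c
    by (simp add: \<phi>) (simp add: const_def)
  have h_mult: "?h (f * g) = ?h f * ?h g" for f g
  proof -
    have "const (?h (f * g)) = (const (?h f * ?h g) :: ('a, 'k) laurent)"
      using const[of f] const[of g] const[of "f * g"] by (simp add: \<phi> const_mult)
    then show ?thesis by (simp add: const_def) (metis lookup_single_eq)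
  qed
  show ?thesis
  proof (rule aff_isoI[where R = ?K and h = ?h])
    show "?h \<in> ring_hom (cut_ring G) ?K"
      using h_mult h_const[of 1] by (intro ring_hom_memI) (simp_all add: cut_ring_def \<phi> lookup_add)
    show "?h ` carrier (cut_ring G) = carrier ?K"
    proof -
      have "c \<in> ?h ` carrier (cut_ring G)" for c
        using h_const[of c] by (intro image_eqI[of _ _ "const c"]) (simp_all add: cut_ring_def)
      then show ?thesis by auto
    qed
    fix f :: "('v, 'k) cut_poly"
    assume "f \<in> carrier (cut_ring G)"
    then show "?h f = \<zero>\<^bsub>?K\<^esub> \<longleftrightarrow> f \<in> cut_ideal G"
      using const[of f] by (auto simp: cut_ideal_iff cut_ring_def)
    show "?h (const c * f) = c \<odot>\<^bsub>point\<^esub> ?h f" for c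
      using h_mult h_const by (simp add: point_def)
  qed (simp_all add: point_def \<open>ring ?K\<close>)
qed

context
  fixes V :: "'u set" and E :: "'u set set" and \<sigma> :: "'u set \<Rightarrow> int"
  assumes VE: "simple_graph V E" and \<sigma>: "multiplicity_map E \<sigma>"
begin

lemma canonical_simps [simp]:
  "verts (canonical V E \<tau>) = V" "edges (canonical V E \<tau>) = E"
  "lab (canonical V E \<tau>) = (\<lambda>e. e)" "multip (canonical V E \<tau>) = \<tau>"
  by (simp_all add: canonical_def)

text \<open>Under the canonical labeling a coordinate determines its edge, hence its factor. The
  default \<open>1\<close> off \<open>E\<close> keeps every factor nonzero, so that
  \<open>scale_exponent\<close> is injective on all exponent vectors.\<close>

definition scale :: "'u set tvar \<Rightarrow> int" where
  "scale x = (let e = (case x of S e \<Rightarrow> e | T e \<Rightarrow> e) in if e \<in> E then \<sigma> e else 1)"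

definition scale_exponent :: "('u set tvar \<Rightarrow>\<^sub>0 int) \<Rightarrow> ('u set tvar \<Rightarrow>\<^sub>0 int)" where
  "scale_exponent m = (\<Sum>x\<in>keys m. single x (scale x * lookup m x))"

lemma scale_exponent_add: "scale_exponent (m + n) = scale_exponent m + scale_exponent n"
  unfolding scale_exponent_def
  by (rule setsum_keys_plus_distrib) (simp_all add: single_add distrib_left)

lemma scale_exponent_single: "scale_exponent (single x k) = single x (scale x * k)"
  by (cases "k = 0") (simp_all add: scale_exponent_def)

lemma scale_exponent_sum: "scale_exponent (\<Sum>i\<in>I. m i) = (\<Sum>i\<in>I. scale_exponent (m i))"
  by (induction I rule: infinite_finite_induct)
    (simp_all add: scale_exponent_add, simp_all add: scale_exponent_def)

lemma inj_scale_exponent: "inj scale_exponent"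
proof (rule injI, rule poly_mapping_eqI)
  fix m n x assume eq: "scale_exponent m = scale_exponent n"
  have "lookup (scale_exponent m) x = scale x * lookup m x" for m
    by (simp add: scale_exponent_def lookup_sum lookup_single when_def in_keys_iff)
  then have "scale x * lookup m x = scale x * lookup n x" using eq by metis
  moreover have "scale x \<noteq> 0"
    using \<sigma> by (simp add: scale_def multiplicity_map_def Let_def)
  ultimately show "lookup m x = lookup n x" by simp
qed

lemma cut_exponent_canonical:
  "cut_exponent (canonical V E \<sigma>) p = scale_exponent (cut_exponent (classical V E) p)"
proof -
  have "cut (canonical V E \<sigma>) p = cut (canonical V E (\<lambda>_. 1)) p" by (simp add: cut_def)
  then show ?thesis
    unfolding cut_exponent_def scale_exponent_sum classical_def
    by (intro sum.cong) (auto simp: scale_exponent_single edge_var_def scale_def)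
qed

lemma cut_ideal_canonical:
  "(cut_ideal (classical V E) :: ('u, 'k::field) cut_poly set) = cut_ideal (canonical V E \<sigma>)"
proof (rule Set.set_eqI)
  fix f :: "('u, 'k) cut_poly"
  show "f \<in> cut_ideal (classical V E) \<longleftrightarrow> f \<in> cut_ideal (canonical V E \<sigma>)"
    using cut_map_subst_kernel[of "classical V E" "canonical V E \<sigma>" f "partitions V" scale_exponent id id]
      finite_edges[OF VE] scale_exponent_add inj_scale_exponent cut_exponent_canonical
    by (auto simp: cut_ideal_iff subst_hom_var_id classical_def)
qed

lemma Aff_canonical: "(Aff (classical V E) :: ('k::field, _) module) \<cong>\<^sub>a Aff (canonical V E \<sigma>)"
  by (rule aff_iso_subst[where \<alpha> = id and \<Theta> = scale_exponent])
    (use finite_edges[OF VE] scale_exponent_add inj_scale_exponent cut_exponent_canonical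
      in \<open>auto simp: classical_def\<close>)

end

section \<open>Clique sums along a vertex\<close>

context
  fixes G :: "('v, 'l) lmgraph" and H :: "('w, 'm) lmgraph" and x y
  assumes G: "simple_graph (verts G) (edges G)" and H: "simple_graph (verts H) (edges H)"
    and x: "x \<in> verts G" and y: "y \<in> verts H"
begin

text \<open>Preimages of the parts under the identification; the two identified vertices thus end up
  in the same part.\<close>

definition unglue :: "('v + 'w) set set \<Rightarrow> ('v + 'w) set set" where
  "unglue p = (\<lambda>A. glue x y -` A \<inter> verts (disjoint_union G H)) ` p"

lemma inj_on_glue_edge: "e \<in> edges (disjoint_union G H) \<Longrightarrow> inj_on (glue x y) e"
  by (auto simp: inj_on_def glue_def)

text \<open>Left edges are unchanged. A right edge has an endpoint other than \<open>y\<close>,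
  which stays on the right and tells it from left edges; it is recovered from its image because it
  contains \<open>y\<close> exactly if the image contains \<open>Inl x\<close>. Hence
  \<open>inv_into\<close> in \<open>zero_sum\<close> finds the original edge.\<close>

lemma inj_on_glue_edges: "inj_on ((`) (glue x y)) (edges (disjoint_union G H))"
proof -
  have range: "glue x y ` Inl ` e = Inl ` e" for e by (auto simp: glue_def)
  have Inr: "\<not> glue x y ` Inr ` e \<subseteq> range Inl" if "e \<in> edges H" for e
  proof -
    have "card e = 2" using H that by (simp add: simple_graph_def)
    then have "\<not> e \<subseteq> {y}" using card_mono[of "{y}" e] by auto
    then obtain z where "z \<in> e" "z \<noteq> y" by blast
    then have "Inr z \<in> glue x y ` Inr ` e" by (force simp: glue_def)
    then show ?thesis by blast
  qed
  have Inr_inj: "e = (if Inl x \<in> glue x y ` Inr ` e then {y} else {}) \<union> (Inr -` glue x y ` Inr ` e)"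
    for e :: "'w set"
    by (auto simp: glue_def image_iff split: if_splits)
  show ?thesis
  proof (rule inj_onI)
    fix d e assume *: "d \<in> edges (disjoint_union G H)" "e \<in> edges (disjoint_union G H)" "glue x y ` d = glue x y ` e"
    consider d' e' where "d = Inl ` d'" "e = Inl ` e'"
      | d' e' where "d = Inl ` d'" "e = Inr ` e'" "e' \<in> edges H"
      | d' e' where "d = Inr ` d'" "e = Inl ` e'" "d' \<in> edges H"
      | d' e' where "d = Inr ` d'" "e = Inr ` e'"
      using *(1,2) by auto
    then show "d = e"
    proof cases
      case 1 then show ?thesis using * by (simp add: range)
    next
      case 2 then show ?thesis using *(3) Inr[of e'] range[of d'] by (metis image_mono subset_UNIV)
    next
      case 3 then show ?thesis using *(3) Inr[of d'] range[of e'] by (metis image_mono subset_UNIV)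
    next
      case 4 then show ?thesis using *(3) Inr_inj[of d'] Inr_inj[of e'] by simp
    qed
  qed
qed

lemma zero_sum_simps:
  "verts (zero_sum x y G H) = glue x y ` verts (disjoint_union G H)" "edges (zero_sum x y G H) = (`) (glue x y) ` edges (disjoint_union G H)"
  "e \<in> edges (disjoint_union G H) \<Longrightarrow> lab (zero_sum x y G H) (glue x y ` e) = lab (disjoint_union G H) e"
  "e \<in> edges (disjoint_union G H) \<Longrightarrow> multip (zero_sum x y G H) (glue x y ` e) = multip (disjoint_union G H) e"
  by (simp_all add: zero_sum_def Let_def inv_into_f_f[OF inj_on_glue_edges] del: disjoint_union_simps)

lemma simple_graph_zero_sum: "simple_graph (verts (zero_sum x y G H)) (edges (zero_sum x y G H))"
proof -
  have D: "simple_graph (verts (disjoint_union G H)) (edges (disjoint_union G H))" by (rule simple_graph_disjoint_union[OF G H])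
  have "glue x y ` e \<subseteq> glue x y ` verts (disjoint_union G H) \<and> card (glue x y ` e) = 2" if "e \<in> edges (disjoint_union G H)" for e
  proof
    have "e \<subseteq> verts (disjoint_union G H)" using D that unfolding simple_graph_def by blast
    then show "glue x y ` e \<subseteq> glue x y ` verts (disjoint_union G H)" by (rule image_mono)
    show "card (glue x y ` e) = 2"
      using D that card_image[OF inj_on_glue_edge[OF that]] by (simp add: simple_graph_def)
  qed
  then show ?thesis
    using D by (simp add: zero_sum_simps simple_graph_def ball_simps del: disjoint_union_simps)
qed

text \<open>An edge meets the preimage of a part exactly if its glued image meets that part, so
  corresponding edges are cut alike; labels and multiplicities are inherited.\<close>

lemma unglue_partition:
  assumes "p \<in> partitions (verts (zero_sum x y G H))"
  shows "unglue p \<in> partitions (verts (disjoint_union G H))" "cut_exponent (disjoint_union G H) (unglue p) = cut_exponent (zero_sum x y G H) p"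
proof -
  obtain a where a: "a \<in> ordered_partitions (verts (zero_sum x y G H))" "p = unordered a"
    using assms by (auto simp: partitions_def)
  let ?b = "(glue x y -` fst a \<inter> verts (disjoint_union G H), glue x y -` snd a \<inter> verts (disjoint_union G H))"
  have b: "?b \<in> ordered_partitions (verts (disjoint_union G H))"
    using a(1) unfolding ordered_partitions_def zero_sum_simps by (auto simp del: disjoint_union_simps)
  have ub: "unglue p = unordered ?b" by (simp add: a unglue_def unordered_def)
  then show "unglue p \<in> partitions (verts (disjoint_union G H))" using b by simp
  have cut: "glue x y ` e \<in> cut (zero_sum x y G H) p \<longleftrightarrow> e \<in> cut (disjoint_union G H) (unglue p)" if e: "e \<in> edges (disjoint_union G H)" for e
  proof -
    have D: "simple_graph (verts (disjoint_union G H)) (edges (disjoint_union G H))" by (rule simple_graph_disjoint_union[OF G H])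
    have "e \<subseteq> verts (disjoint_union G H)" using D e by (simp add: simple_graph_def del: disjoint_union_simps)
    then have "e \<in> cut (disjoint_union G H) (unordered ?b) \<longleftrightarrow> glue x y ` e \<inter> fst a \<noteq> {} \<and> glue x y ` e \<inter> snd a \<noteq> {}"
      by (subst cut_unordered_simple[OF D b e]) auto
    also have "\<dots> \<longleftrightarrow> glue x y ` e \<in> cut (zero_sum x y G H) p"
      unfolding a(2) by (rule cut_unordered_simple[OF simple_graph_zero_sum a(1), symmetric])
        (simp add: zero_sum_simps e del: disjoint_union_simps)
    finally show ?thesis by (simp add: ub)
  qed
  show "cut_exponent (disjoint_union G H) (unglue p) = cut_exponent (zero_sum x y G H) p"
    unfolding cut_exponent_def zero_sum_simps
    unfolding sum.reindex[OF inj_on_glue_edges]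
    by (rule sum.cong[OF refl]) (simp add: zero_sum_simps edge_var_def cut del: disjoint_union_simps)
qed

text \<open>Of the two partitions \<open>a \<times> b\<close> and \<open>a \<times> b\<^sup>*\<close>, which have the same image, exactly one does
  not separate the two vertices to be identified, and this one descends to the clique sum.\<close>

lemma unglue_surj:
  assumes "q \<in> partitions (verts (disjoint_union G H))"
  shows "\<exists>p\<in>partitions (verts (zero_sum x y G H)). cut_exponent (disjoint_union G H) (unglue p) = cut_exponent (disjoint_union G H) q"
proof -
  obtain a b where ab: "a \<in> ordered_partitions (verts G)" "b \<in> ordered_partitions (verts H)"
      "q = part_prod a b"
    using assms partition_Plus_cases by (metis disjoint_union_simps(1))
  define b' where "b' = (if x \<in> fst a \<longleftrightarrow> y \<in> fst b then b else prod.swap b)"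
  have b': "b' \<in> ordered_partitions (verts H)" "unordered b' = unordered b"
    using ab(2) by (simp_all add: b'_def)
  have "x \<in> fst a \<longleftrightarrow> y \<in> fst b'" "x \<in> snd a \<longleftrightarrow> y \<in> snd b'"
    using ab(1,2) x y by (auto simp: b'_def ordered_partitions_def)
  define c where "c = ordered_prod a b'"
  have c: "c \<in> ordered_partitions (verts (disjoint_union G H))"
    using ab b' by (simp add: c_def)
  have c_glue: "Inl x \<in> fst c \<longleftrightarrow> Inr y \<in> fst c" "Inl x \<in> snd c \<longleftrightarrow> Inr y \<in> snd c"
    using \<open>x \<in> fst a \<longleftrightarrow> _\<close> \<open>x \<in> snd a \<longleftrightarrow> _\<close> by (auto simp: c_def ordered_prod_def)
  let ?p = "(glue x y ` fst c, glue x y ` snd c)"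
  \<comment> \<open>Such a \<open>C\<close> is a union of fibres of the identification, hence the
    preimage of its own image.\<close>
  have glue_mem: "glue x y u \<in> glue x y ` C \<longleftrightarrow> u \<in> C" if "Inl x \<in> C \<longleftrightarrow> Inr y \<in> C" for u C
    using that by (auto simp: glue_def image_iff split: if_splits)
  have p: "?p \<in> ordered_partitions (verts (zero_sum x y G H))"
  proof -
    have "glue x y ` fst c \<inter> glue x y ` snd c = {}"
    proof (rule equals0I)
      fix w assume "w \<in> glue x y ` fst c \<inter> glue x y ` snd c"
      then obtain v where v: "w = glue x y v" "v \<in> snd c" and "w \<in> glue x y ` fst c"
        by (elim IntE) (erule imageE)
      then have "v \<in> fst c" using glue_mem[OF c_glue(1)] by simp
      then show False using v(2) c by (auto simp: ordered_partitions_iff)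
    qed
    moreover have "fst c \<union> snd c = verts (disjoint_union G H)" using c by (simp add: ordered_partitions_iff)
    ultimately show ?thesis
      by (simp add: ordered_partitions_iff zero_sum_simps del: disjoint_union_simps flip: image_Un)
  qed
  have "fst c \<subseteq> verts (disjoint_union G H)" "snd c \<subseteq> verts (disjoint_union G H)"
    using c unfolding ordered_partitions_iff by auto
  then have "glue x y -` (glue x y ` fst c) \<inter> verts (disjoint_union G H) = fst c"
      "glue x y -` (glue x y ` snd c) \<inter> verts (disjoint_union G H) = snd c"
    by (simp_all add: vimage_def glue_mem c_glue Int_absorb2 del: disjoint_union_simps)
  then have "unglue (unordered ?p) = unordered c"
    by (simp add: unglue_def unordered_def del: disjoint_union_simps)
  also have "\<dots> = part_prod a b'" by (simp add: c_def part_prod_eq_unordered)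
  finally have "cut_exponent (disjoint_union G H) (unglue (unordered ?p)) = cut_exponent (disjoint_union G H) q"
    using ab b' by (simp add: cut_exponent_disjoint_union[OF G H])
  then show ?thesis using unordered_partitions[OF p] by (rule rev_bexI[rotated])
qed

text \<open>\<open>unglue\<close> goes from the clique sum to the disjoint union. Choosing for each
  partition of the union one of the sum with the same exponent vector gives a map in the required
  direction.\<close>

lemma Aff_zero_sum: "(Aff (disjoint_union G H) :: ('k::field, _) module) \<cong>\<^sub>a Aff (zero_sum x y G H)"
proof -
  obtain \<alpha> where \<alpha>: "\<alpha> q \<in> partitions (verts (zero_sum x y G H))" "cut_exponent (disjoint_union G H) (unglue (\<alpha> q)) = cut_exponent (disjoint_union G H) q"
    if "q \<in> partitions (verts (disjoint_union G H))" for q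
    using unglue_surj by metis
  show ?thesis
  proof (rule aff_iso_subst[where \<alpha> = \<alpha> and \<Theta> = id])
    show "finite (edges (zero_sum x y G H))" "finite (edges (disjoint_union G H))"
      using finite_edges simple_graph_zero_sum simple_graph_disjoint_union[OF G H] by blast+
    show exp: "cut_exponent (zero_sum x y G H) (\<alpha> q) = id (cut_exponent (disjoint_union G H) q)" if "q \<in> partitions (verts (disjoint_union G H))" for q
      using \<alpha>[OF that] unglue_partition(2)[of "\<alpha> q"] by simp
    show "\<exists>q\<in>partitions (verts (disjoint_union G H)). cut_exponent (zero_sum x y G H) (\<alpha> q) = cut_exponent (zero_sum x y G H) p"
      if "p \<in> partitions (verts (zero_sum x y G H))" for p
      using exp unglue_partition[OF that] by force
  qed (simp_all add: \<alpha>(1) del: disjoint_union_simps)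
qed

end

section \<open>Adding isolated vertices\<close>

lemma set_add_iff: "f \<in> A <+>\<^bsub>R\<^esub> B \<longleftrightarrow> (\<exists>g\<in>A. \<exists>h\<in>B. f = g \<oplus>\<^bsub>R\<^esub> h)"
  by (auto simp: set_add_def')

context
  fixes G :: "('v, 'l) lmgraph" and H :: "('w, 'm) lmgraph"
    and ord :: "'v set set \<Rightarrow> 'v set \<times> 'v set"
  assumes G: "simple_graph (verts G) (edges G)" and H: "simple_graph (verts H) (edges H)"
    and H_edgeless: "edges H = {}"
    and ord: "\<And>p. p \<in> partitions (verts G) \<Longrightarrow>
      ord p \<in> ordered_partitions (verts G) \<and> unordered (ord p) = p"
begin

definition ext_part :: "'v set set \<Rightarrow> ('v + 'w) set set" where
  "ext_part p = part_prod (ord p) ({}, verts H)"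

lemma cut_exponent_edgeless_union:
  assumes "a \<in> ordered_partitions (verts G)" "b \<in> ordered_partitions (verts H)"
  shows "cut_exponent (disjoint_union G H) (part_prod a b) = map_tvars Inl (cut_exponent G (unordered a))"
  using cut_exponent_disjoint_union[OF G H assms] H_edgeless by simp

lemma ext_part:
  assumes "p \<in> partitions (verts G)"
  shows "ext_part p \<in> partitions (verts (disjoint_union G H))"
    "cut_exponent (disjoint_union G H) (ext_part p) = map_tvars Inl (cut_exponent G p)"
  using ord[OF assms] by (simp_all add: ext_part_def cut_exponent_edgeless_union)

lemma finite_edges_GH: "finite (edges G)" "finite (edges (disjoint_union G H))"
  using finite_edges[OF G] H_edgeless by simp_all

text \<open>All edges come from \<open>G\<close>, so \<open>a\<close> alone determines the exponent
  vector of \<open>a \<times> b\<close>.\<close>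

lemma restrict_part:
  assumes "q \<in> partitions (verts (disjoint_union G H))"
  shows "\<exists>p\<in>partitions (verts G). cut_exponent (disjoint_union G H) q = map_tvars Inl (cut_exponent G p)"
proof -
  obtain a b where "a \<in> ordered_partitions (verts G)" "b \<in> ordered_partitions (verts H)" "q = part_prod a b"
    using assms partition_Plus_cases by (metis disjoint_union_simps(1))
  then show ?thesis using cut_exponent_edgeless_union unordered_partitions by metis
qed

lemma Aff_union_edgeless: "(Aff G :: ('k::field, _) module) \<cong>\<^sub>a Aff (disjoint_union G H)"
proof (rule aff_iso_subst[where \<alpha> = ext_part and \<Theta> = "map_tvars Inl"])
  show "\<exists>p\<in>partitions (verts G). cut_exponent (disjoint_union G H) (ext_part p) = cut_exponent (disjoint_union G H) q"
    if "q \<in> partitions (verts (disjoint_union G H))" for q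
    using restrict_part[OF that] ext_part(2) by metis
qed (rule finite_edges_GH ext_part map_tvars_add inj_map_tvars[OF inj_Inl] | assumption)+

text \<open>Modulo the linear forms \<open>?lin q\<close> every polynomial \<open>f\<close> equals
  the extension of its restriction \<open>?res f\<close>. For \<open>f\<close> in the ideal,
  \<open>?res f\<close> lies in the ideal of \<open>G\<close>, which splits \<open>f\<close> into an
  extended element and an element of \<open>?J\<close>.\<close>

lemma cut_ideal_union_edgeless:
  fixes R :: "('v + 'w, 'k::field) cut_poly ring"
  defines "R \<equiv> cut_ring (disjoint_union G H)"
  shows "\<exists>L J. L \<subseteq> carrier R \<and> (\<forall>f\<in>L. linear_form f) \<and> J = Idl\<^bsub>R\<^esub> L \<and>
    cut_ideal (disjoint_union G H) = Idl\<^bsub>R\<^esub> (extend_vars ord (verts H) ` cut_ideal G) <+>\<^bsub>R\<^esub> J"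
proof -
  let ?X = "partitions (verts (disjoint_union G H))" and ?Y = "partitions (verts G)"
  let ?I = "cut_ideal (disjoint_union G H) :: ('v + 'w, 'k) cut_poly set"
  have R: "R = poly_ring ?X" by (simp add: R_def cut_ring_def)
  interpret cring R unfolding R by (rule poly_ring_cring)
  interpret I: ideal ?I R unfolding R_def by (rule cut_ideal_ideal)
  \<comment> \<open>\<open>\<beta> q\<close> is any partition of \<open>G\<close> with the right
    exponent vector, not necessarily the trace of \<open>q\<close>; both the linear forms and the
    restriction refer to exponent vectors only.\<close>
  obtain \<beta> where \<beta>: "\<beta> q \<in> ?Y" "cut_exponent (disjoint_union G H) q = map_tvars Inl (cut_exponent G (\<beta> q))"
    if "q \<in> ?X" for q
    using restrict_part by metis
  let ?ext = "extend_vars ord (verts H) :: ('v, 'k) cut_poly \<Rightarrow> ('v + 'w, 'k) cut_poly"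
  let ?res = "subst_hom (\<lambda>q. var (\<beta> q)) :: ('v + 'w, 'k) cut_poly \<Rightarrow> ('v, 'k) cut_poly"
  let ?lin = "\<lambda>q. var q - var (ext_part (\<beta> q)) :: ('v + 'w, 'k) cut_poly"
  let ?J = "Idl\<^bsub>R\<^esub> (?lin ` ?X)" and ?I' = "Idl\<^bsub>R\<^esub> (?ext ` cut_ideal G)"
  have ext: "?ext = subst_hom (\<lambda>p. var (ext_part p))"
    by (simp add: extend_vars_def ext_part_def)
  have ext_closed: "?ext f \<in> carrier R" if "f \<in> carrier (poly_ring ?Y)" for f
    using that unfolding ext R by (rule subst_hom_closed) (simp add: ext_part del: disjoint_union_simps)
  have res_closed: "?res f \<in> carrier (poly_ring ?Y)" if "f \<in> carrier R" for f
    using that unfolding R by (rule subst_hom_closed) (simp add: \<beta>(1) del: disjoint_union_simps)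
  have L_carrier: "?lin ` ?X \<subseteq> carrier R"
    using ext_part(1) \<beta>(1) unfolding R by (auto simp del: disjoint_union_simps)
  have linear: "linear_form (?lin q)" for q
  proof -
    \<comment> \<open>Only an inclusion: for \<open>q = ext_part (\<beta> q)\<close> the form is
      \<open>0\<close>, which counts as linear.\<close>
    have "keys (?lin q) \<subseteq> {single q 1, single (ext_part (\<beta> q)) 1}"
      by (auto simp: var_def monomial_def in_keys_iff lookup_minus lookup_single when_def split: if_splits)
    then show ?thesis unfolding linear_form_def by auto
  qed
  have ext_ideal: "?ext ` cut_ideal G \<subseteq> ?I"
  proof
    fix g assume "g \<in> ?ext ` cut_ideal G"
    then obtain f where f: "f \<in> cut_ideal G" "g = ?ext f" by (rule imageE)
    have f': "f \<in> carrier (poly_ring ?Y)" "cut_map G f = (0 :: ('l, 'k) laurent)"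
      using f(1) by (simp_all add: cut_ideal_iff)
    have "cut_map (disjoint_union G H) (?ext f) = (0 :: ('l + 'm, 'k) laurent)"
      using cut_map_subst_kernel[OF finite_edges_GH f'(1) map_tvars_add inj_map_tvars[OF inj_Inl],
          where \<beta> = ext_part and \<alpha> = id] ext_part(2) f'(2)
      by (simp add: ext subst_hom_var_id del: disjoint_union_simps)
    then show "g \<in> ?I"
      using ext_closed[OF f'(1)] f(2) by (simp add: cut_ideal_iff R del: disjoint_union_simps)
  qed
  have L_ideal: "?lin ` ?X \<subseteq> ?I"
  proof
    fix g assume g: "g \<in> ?lin ` ?X"
    then obtain q where q: "q \<in> ?X" "g = ?lin q" by (elim imageE)
    have "cut_map (disjoint_union G H) g = (0 :: ('l + 'm, 'k) laurent)"
      unfolding q(2) cut_map_eq_subst_hom[OF finite_edges_GH(2)]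
      using \<beta>[OF q(1)] ext_part(2)[of "\<beta> q"] by simp
    moreover have "g \<in> carrier (poly_ring ?X)" using subsetD[OF L_carrier g] unfolding R .
    ultimately show "g \<in> ?I" unfolding cut_ideal_iff by (rule conjI[rotated])
  qed
  have E_carrier: "?ext ` cut_ideal G \<subseteq> carrier R"
    using ext_ideal I.a_subset by (rule order_trans)
  interpret J: ideal ?J R by (rule genideal_ideal[OF L_carrier])
  have cong: "f - ?ext (?res f) \<in> ?J" if "f \<in> carrier (poly_ring ?X)" for f
    using that
  proof (induction rule: poly_ring_induct)
    case (const c)
    then show ?case using J.zero_closed by (simp add: ext R)
  next
    case (var q)
    then have "?lin q \<in> ?J" by (rule subsetD[OF genideal_self[OF L_carrier] imageI])
    then show ?case by (simp add: ext)
  next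
    case (add f g)
    then have "(f - ?ext (?res f)) \<oplus>\<^bsub>R\<^esub> (g - ?ext (?res g)) \<in> ?J" by (intro J.a_closed)
    then show ?case by (simp add: ext R algebra_simps)
  next
    case (mult f g)
    \<comment> \<open>With \<open>F\<close> and \<open>G'\<close> for the extended restrictions of
      \<open>f\<close> and \<open>g\<close>, this is
      \<open>f g - F G' = (f - F) g + F (g - G')\<close>.\<close>
    have "(f - ?ext (?res f)) \<otimes>\<^bsub>R\<^esub> g \<oplus>\<^bsub>R\<^esub> ?ext (?res f) \<otimes>\<^bsub>R\<^esub> (g - ?ext (?res g)) \<in> ?J"
      using mult ext_closed[OF res_closed] unfolding R[symmetric]
      by (intro J.a_closed J.I_r_closed J.I_l_closed)
    then show ?case by (simp add: ext R algebra_simps)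
  qed
  have "?I = ?I' <+>\<^bsub>R\<^esub> ?J"
  proof (intro equalityI subsetI)
    fix f assume f: "f \<in> ?I"
    then have fR: "f \<in> carrier (poly_ring ?X)" and f0: "cut_map (disjoint_union G H) f = (0 :: ('l + 'm, 'k) laurent)"
      by (simp_all add: cut_ideal_iff del: disjoint_union_simps)
    have "cut_map G (?res f) = (0 :: ('l, 'k) laurent)"
      using cut_map_subst_kernel[OF finite_edges_GH fR map_tvars_add inj_map_tvars[OF inj_Inl],
          where \<beta> = id and \<alpha> = \<beta>] \<beta>(2) f0
      by (simp add: subst_hom_var_id del: disjoint_union_simps)
    then have "?res f \<in> cut_ideal G"
      using res_closed fR by (simp add: cut_ideal_iff R del: disjoint_union_simps)
    then have "?ext (?res f) \<in> ?I'"
      by (rule subsetD[OF genideal_self[OF E_carrier] imageI])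
    moreover have "f = ?ext (?res f) \<oplus>\<^bsub>R\<^esub> (f - ?ext (?res f))" by (simp add: R)
    ultimately show "f \<in> ?I' <+>\<^bsub>R\<^esub> ?J"
      using cong[OF fR] unfolding set_add_iff by (intro bexI)
  next
    fix f assume "f \<in> ?I' <+>\<^bsub>R\<^esub> ?J"
    then obtain g h where gh: "g \<in> ?I'" "h \<in> ?J" "f = g \<oplus>\<^bsub>R\<^esub> h"
      unfolding set_add_iff by (elim bexE)
    have "?I' \<subseteq> ?I" by (rule genideal_minimal[OF I.ideal_axioms ext_ideal])
    moreover have "?J \<subseteq> ?I" by (rule genideal_minimal[OF I.ideal_axioms L_ideal])
    ultimately have "g \<in> ?I" "h \<in> ?I" using gh(1,2) by (simp_all only: subsetD)
    then show "f \<in> ?I" unfolding gh(3) by (rule I.a_closed)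
  qed
  moreover have "\<forall>f\<in>?lin ` ?X. linear_form f" using linear by (simp only: ball_simps) simp
  ultimately show ?thesis
    using L_carrier by (intro exI[of _ "?lin ` ?X"] exI[of _ ?J] conjI refl)
qed

end

lemma isolated_simps [simp]: "verts (isolated n) = {1..n}" "edges (isolated n) = {}"
  by (simp_all add: isolated_def classical_def canonical_def)

lemma simple_graph_isolated: "n \<ge> 1 \<Longrightarrow> simple_graph (verts (isolated n)) (edges (isolated n))"
  by (simp add: simple_graph_def)

lemma Aff_union_isolated:
  assumes "simple_graph (verts G) (edges G)" "n \<ge> 1"
  shows "(Aff (disjoint_union G (isolated n)) :: ('k::field, _) module) \<cong>\<^sub>a Aff G"
proof -
  have "\<forall>p\<in>partitions (verts G). \<exists>a. a \<in> ordered_partitions (verts G) \<and> unordered a = p"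
    by (auto simp: partitions_def)
  from bchoice[OF this] obtain ord where "\<forall>p\<in>partitions (verts G).
      ord p \<in> ordered_partitions (verts G) \<and> unordered (ord p) = p" ..
  from Aff_union_edgeless[OF assms(1) simple_graph_isolated[OF assms(2)] isolated_simps(2) bspec[OF this]]
  show ?thesis by (rule aff_iso_Aff_sym)
qed

section \<open>Binomials\<close>

text \<open>The membership criterion of toric ideals: both products go to Laurent monomials, whose
  difference vanishes only if their exponents agree.\<close>

lemma prod_binomial_in_cut_ideal:
  assumes "finite (edges G)" "\<And>j. j \<in> J \<union> K \<Longrightarrow> p j \<in> partitions (verts G)"
  shows "(\<Prod>j\<in>J. var (p j)) - (\<Prod>j\<in>K. var (p j)) \<in> (cut_ideal G :: ('v, 'k::field) cut_poly set) \<longleftrightarrow>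
    (\<Sum>j\<in>J. cut_exponent G (p j)) = (\<Sum>j\<in>K. cut_exponent G (p j))"
proof -
  have "(cut_map G ((\<Prod>j\<in>J. var (p j)) - (\<Prod>j\<in>K. var (p j))) :: ('a, 'k) laurent) =
      monomial (\<Sum>j\<in>J. cut_exponent G (p j)) - monomial (\<Sum>j\<in>K. cut_exponent G (p j))"
    using assms(1) by (simp add: cut_map_eq_subst_hom monomial_sum)
  then show ?thesis
    using assms(2) by (simp add: cut_ideal_iff)
qed

lemma prod_split_shift:
  fixes f :: "nat \<Rightarrow> 'r::comm_monoid_mult"
  shows "(\<Prod>j\<in>{h + 1..h + k}. f j) = (\<Prod>j\<in>{1..k}. f (j + h))"
  using prod.shift_bounds_cl_nat_ivl[of f 1 h k] by (simp add: add.commute)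

lemma shifted_index: "j \<in> {1..h + k} \<Longrightarrow> \<not> j \<le> h \<Longrightarrow> j - h \<in> {1..k::nat}"
  unfolding atLeastAtMost_iff by linarith

text \<open>Lists the factors of a monomial with repetitions. For a sum of exponents the two lists
  are concatenated, so indices beyond \<open>h\<close> are shifted back by \<open>h\<close>.\<close>

lemma monomial_eq_prod_var:
  assumes "keys u \<subseteq> X"
  shows "\<exists>h q. (\<forall>j\<in>{1..h::nat}. q j \<in> X) \<and>
    (monomial u :: ('x, 'k::comm_ring_1) polyn) = (\<Prod>j\<in>{1..h}. var (q j))"
  using assms
proof (induction u rule: poly_mapping_induct)
  case zero
  show ?case by (rule exI[of _ 0]) simp
next
  case (single x n)
  have "monomial (single x n) = (\<Prod>j\<in>{1..n}. var x :: ('x, 'k) polyn)"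
    by (simp add: var_power)
  then show ?case using single by (intro exI[of _ n] exI[of _ "\<lambda>_. x"]) simp
next
  case (add u v)
  then obtain h q k r where q: "\<forall>j\<in>{1..h::nat}. q j \<in> X" "\<forall>j\<in>{1..k::nat}. r j \<in> X"
    and m: "(monomial u :: ('x, 'k) polyn) = (\<Prod>j\<in>{1..h}. var (q j))"
      "(monomial v :: ('x, 'k) polyn) = (\<Prod>j\<in>{1..k}. var (r j))" by blast
  let ?s = "\<lambda>j. if j \<le> h then q j else r (j - h)"
  have "(\<Prod>j\<in>{1..h + k}. var (?s j) :: ('x, 'k) polyn) =
      (\<Prod>j\<in>{1..h}. var (?s j)) * (\<Prod>j\<in>{h + 1..h + k}. var (?s j))"
    by (rule prod.ub_add_nat) simp
  also have "\<dots> = monomial (u + v)"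
    unfolding prod_split_shift by (simp add: m monomial_add)
  finally have "monomial (u + v) = (\<Prod>j\<in>{1..h + k}. var (?s j) :: ('x, 'k) polyn)" by simp
  moreover have "?s j \<in> X" if "j \<in> {1..h + k}" for j
    using that q shifted_index[of j h k] by (cases "j \<le> h") simp_all
  ultimately show ?case by (intro exI[of _ "h + k"] exI[of _ ?s]) simp
qed

text \<open>Each edge with label \<open>c\<close> contributes its multiplicity to exactly one of the
  two coordinates. The total does not depend on \<open>p\<close>, so it counts the factors of a
  product.\<close>

lemma lookup_cut_exponent:
  assumes "finite (edges G)"
  shows "lookup (cut_exponent G p) (S c) + lookup (cut_exponent G p) (T c) = label_total G c"
proof -
  have "lookup (cut_exponent G p) (S c) + lookup (cut_exponent G p) (T c) =
      (\<Sum>e\<in>edges G. if lab G e = c then multip G e else 0)"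
    unfolding cut_exponent_def lookup_sum sum.distrib[symmetric]
    by (rule sum.cong) (auto simp: edge_var_def lookup_single when_def)
  also have "\<dots> = label_total G c"
    unfolding label_total_def using assms by (simp add: sum.inter_filter)
  finally show ?thesis .
qed

section \<open>Binomials in the cut ideal of a disjoint union\<close>

context
  fixes G :: "('v, 'l) lmgraph" and H :: "('w, 'm) lmgraph"
  assumes G: "simple_graph (verts G) (edges G)" and H: "simple_graph (verts H) (edges H)"
begin

lemma finite_edges_GUH: "finite (edges (disjoint_union G H))"
  by (rule finite_edges[OF simple_graph_disjoint_union[OF G H]])

lemma part_prod_binomial_iff:
  assumes "\<And>j. j \<in> J \<union> K \<Longrightarrow> a j \<in> ordered_partitions (verts G) \<and> b j \<in> ordered_partitions (verts H)"
  shows "(\<Prod>j\<in>J. var (part_prod (a j) (b j))) - (\<Prod>j\<in>K. var (part_prod (a j) (b j)))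
      \<in> (cut_ideal (disjoint_union G H) :: ('v + 'w, 'k::field) cut_poly set) \<longleftrightarrow>
    (\<Prod>j\<in>J. var (unordered (a j))) - (\<Prod>j\<in>K. var (unordered (a j))) \<in> (cut_ideal G :: ('v, 'k) cut_poly set) \<and>
    (\<Prod>j\<in>J. var (unordered (b j))) - (\<Prod>j\<in>K. var (unordered (b j))) \<in> (cut_ideal H :: ('w, 'k) cut_poly set)"
proof -
  have sum: "(\<Sum>j\<in>M. cut_exponent (disjoint_union G H) (part_prod (a j) (b j))) =
      map_tvars Inl (\<Sum>j\<in>M. cut_exponent G (unordered (a j))) +
      map_tvars Inr (\<Sum>j\<in>M. cut_exponent H (unordered (b j)))" if "M \<subseteq> J \<union> K" for M
  proof -
    have "(\<Sum>j\<in>M. cut_exponent (disjoint_union G H) (part_prod (a j) (b j))) =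
        (\<Sum>j\<in>M. map_tvars Inl (cut_exponent G (unordered (a j))) + map_tvars Inr (cut_exponent H (unordered (b j))))"
      by (rule sum.cong[OF refl], rule cut_exponent_disjoint_union[OF G H]) (use assms that in auto)
    then show ?thesis by (simp add: map_tvars_sum sum.distrib)
  qed
  have "(\<Prod>j\<in>J. var (part_prod (a j) (b j))) - (\<Prod>j\<in>K. var (part_prod (a j) (b j)))
      \<in> (cut_ideal (disjoint_union G H) :: ('v + 'w, 'k) cut_poly set) \<longleftrightarrow>
    (\<Sum>j\<in>J. cut_exponent (disjoint_union G H) (part_prod (a j) (b j))) = (\<Sum>j\<in>K. cut_exponent (disjoint_union G H) (part_prod (a j) (b j)))"
    using assms by (intro prod_binomial_in_cut_ideal[OF finite_edges_GUH]) auto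
  also have "\<dots> \<longleftrightarrow>
      (\<Sum>j\<in>J. cut_exponent G (unordered (a j))) = (\<Sum>j\<in>K. cut_exponent G (unordered (a j))) \<and>
      (\<Sum>j\<in>J. cut_exponent H (unordered (b j))) = (\<Sum>j\<in>K. cut_exponent H (unordered (b j)))"
    unfolding sum[of J, OF Un_upper1] sum[of K, OF Un_upper2] by (rule map_tvars_Inl_Inr_eq_iff)
  also have "(\<Sum>j\<in>J. cut_exponent G (unordered (a j))) = (\<Sum>j\<in>K. cut_exponent G (unordered (a j))) \<longleftrightarrow>
      (\<Prod>j\<in>J. var (unordered (a j))) - (\<Prod>j\<in>K. var (unordered (a j))) \<in> (cut_ideal G :: ('v, 'k) cut_poly set)"
    using assms by (intro prod_binomial_in_cut_ideal[OF finite_edges[OF G], symmetric]) auto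
  also have "(\<Sum>j\<in>J. cut_exponent H (unordered (b j))) = (\<Sum>j\<in>K. cut_exponent H (unordered (b j))) \<longleftrightarrow>
      (\<Prod>j\<in>J. var (unordered (b j))) - (\<Prod>j\<in>K. var (unordered (b j))) \<in> (cut_ideal H :: ('w, 'k) cut_poly set)"
    using assms by (intro prod_binomial_in_cut_ideal[OF finite_edges[OF H], symmetric]) auto
  finally show ?thesis .
qed

lemma interval_split: "{1..h} \<union> {h + 1..h + k} = {1..h + k :: nat}"
  by auto

text \<open>Trades the two memberships in the definition for one membership and a mere shape. The
  equivalence of memberships holds for every choice of \<open>a\<close> and \<open>b\<close>, so the
  given presentation of \<open>f\<close> can be kept.\<close>

lemma product_binomial_iff:
  fixes f :: "('v + 'w, 'k::field) cut_poly"
  shows "product_binomial G H h k f \<longleftrightarrow> f \<in> cut_ideal (disjoint_union G H) \<and>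
    (\<exists>a b. (\<forall>j\<in>{1..h + k}. a j \<in> ordered_partitions (verts G) \<and> b j \<in> ordered_partitions (verts H)) \<and>
      f = (\<Prod>j\<in>{1..h}. var (part_prod (a j) (b j))) - (\<Prod>j\<in>{h + 1..h + k}. var (part_prod (a j) (b j))))"
proof -
  have iff: "(\<Prod>j\<in>{1..h}. var (part_prod (a j) (b j))) - (\<Prod>j\<in>{h + 1..h + k}. var (part_prod (a j) (b j)))
      \<in> (cut_ideal (disjoint_union G H) :: ('v + 'w, 'k) cut_poly set) \<longleftrightarrow>
    (\<Prod>j\<in>{1..h}. var (unordered (a j))) - (\<Prod>j\<in>{h + 1..h + k}. var (unordered (a j)))
      \<in> (cut_ideal G :: ('v, 'k) cut_poly set) \<and>
    (\<Prod>j\<in>{1..h}. var (unordered (b j))) - (\<Prod>j\<in>{h + 1..h + k}. var (unordered (b j)))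
      \<in> (cut_ideal H :: ('w, 'k) cut_poly set)"
    if "\<forall>j\<in>{1..h + k}. a j \<in> ordered_partitions (verts G) \<and> b j \<in> ordered_partitions (verts H)" for a b
    by (rule part_prod_binomial_iff, unfold interval_split) (use that in blast)
  show ?thesis unfolding product_binomial_def
  proof (intro iffI; elim exE conjE)
    fix a b
    assume *: "\<forall>j\<in>{1..h + k}. a j \<in> ordered_partitions (verts G) \<and> b j \<in> ordered_partitions (verts H)"
      "f = (\<Prod>j\<in>{1..h}. var (part_prod (a j) (b j))) - (\<Prod>j\<in>{h + 1..h + k}. var (part_prod (a j) (b j)))"
    {
      assume "(\<Prod>j\<in>{1..h}. var (unordered (a j))) - (\<Prod>j\<in>{h + 1..h + k}. var (unordered (a j)))
          \<in> (cut_ideal G :: ('v, 'k) cut_poly set)"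
        "(\<Prod>j\<in>{1..h}. var (unordered (b j))) - (\<Prod>j\<in>{h + 1..h + k}. var (unordered (b j)))
          \<in> (cut_ideal H :: ('w, 'k) cut_poly set)"
      then have "f \<in> cut_ideal (disjoint_union G H)" unfolding *(2) iff[OF *(1)] by (rule conjI)
      with * show "f \<in> cut_ideal (disjoint_union G H) \<and> (\<exists>a b. (\<forall>j\<in>{1..h + k}.
          a j \<in> ordered_partitions (verts G) \<and> b j \<in> ordered_partitions (verts H)) \<and>
          f = (\<Prod>j\<in>{1..h}. var (part_prod (a j) (b j))) - (\<Prod>j\<in>{h + 1..h + k}. var (part_prod (a j) (b j))))"
        by (intro conjI exI[of _ a] exI[of _ b])
    }
    assume "f \<in> cut_ideal (disjoint_union G H)"
    from this[unfolded *(2) iff[OF *(1)]]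
    show "\<exists>a b. (\<forall>j\<in>{1..h + k}. a j \<in> ordered_partitions (verts G) \<and> b j \<in> ordered_partitions (verts H)) \<and>
        f = (\<Prod>j\<in>{1..h}. var (part_prod (a j) (b j))) - (\<Prod>j\<in>{h + 1..h + k}. var (part_prod (a j) (b j))) \<and>
        (\<Prod>j\<in>{1..h}. var (unordered (a j))) - (\<Prod>j\<in>{h + 1..h + k}. var (unordered (a j)))
          \<in> (cut_ideal G :: ('v, 'k) cut_poly set) \<and>
        (\<Prod>j\<in>{1..h}. var (unordered (b j))) - (\<Prod>j\<in>{h + 1..h + k}. var (unordered (b j)))
          \<in> (cut_ideal H :: ('w, 'k) cut_poly set)"
      using * by (intro exI[of _ a] exI[of _ b] conjI) (assumption | erule conjunct1 conjunct2)+
  qed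
qed

lemma swap_binomial_in_cut_ideal:
  assumes "swap_binomial G H f"
  shows "f \<in> (cut_ideal (disjoint_union G H) :: ('v + 'w, 'k::field) cut_poly set)"
proof -
  obtain a b where ab: "a \<in> ordered_partitions (verts G)" "b \<in> ordered_partitions (verts H)"
    and f: "f = var (part_prod a b) - var (part_prod a (prod.swap b))"
    using assms by (auto simp: swap_binomial_def)
  then show ?thesis
    by (simp add: cut_ideal_iff cut_map_eq_subst_hom[OF finite_edges_GUH]
        cut_exponent_disjoint_union[OF G H])
qed

text \<open>Every monomial is a product of variables and every partition of the union a product
  partition, so any binomial has the shape; \<open>h\<close> and \<open>k\<close> are the degrees of
  its two monomials.\<close>

lemma binomial_imp_product_binomial:
  fixes f :: "('v + 'w, 'k::field) cut_poly"
  assumes "f \<in> binomials (partitions (verts (disjoint_union G H)))" and "f \<in> cut_ideal (disjoint_union G H)"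
  shows "\<exists>h k. product_binomial G H h k f"
proof -
  let ?X = "partitions (verts (disjoint_union G H))"
  obtain u v where f: "f = monomial u - monomial v" "keys u \<subseteq> ?X" "keys v \<subseteq> ?X"
    using assms(1) by (auto simp: binomials_def)
  obtain h q where q: "\<forall>j\<in>{1..h::nat}. q j \<in> ?X"
    "(monomial u :: ('v + 'w, 'k) cut_poly) = (\<Prod>j\<in>{1..h}. var (q j))"
    using monomial_eq_prod_var[OF f(2)] by blast
  obtain k r where r: "\<forall>j\<in>{1..k::nat}. r j \<in> ?X"
    "(monomial v :: ('v + 'w, 'k) cut_poly) = (\<Prod>j\<in>{1..k}. var (r j))"
    using monomial_eq_prod_var[OF f(3)] by blast
  let ?s = "\<lambda>j. if j \<le> h then q j else r (j - h)"
  have "\<exists>a b. a \<in> ordered_partitions (verts G) \<and> b \<in> ordered_partitions (verts H) \<and> ?s j = part_prod a b"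
    if "j \<in> {1..h + k}" for j
  proof -
    have "?s j \<in> partitions (verts G <+> verts H)"
      using that q(1) r(1) shifted_index[of j h k] by (cases "j \<le> h") simp_all
    then show ?thesis by (elim partition_Plus_cases) blast
  qed
  then obtain a b where ab: "\<forall>j\<in>{1..h + k}. a j \<in> ordered_partitions (verts G) \<and>
      b j \<in> ordered_partitions (verts H) \<and> ?s j = part_prod (a j) (b j)" by metis
  have s: "var (part_prod (a j) (b j)) = (var (?s j) :: ('v + 'w, 'k) cut_poly)" if "j \<in> {1..h + k}" for j
    using ab that by simp
  have "(\<Prod>j\<in>{1..h}. var (part_prod (a j) (b j))) = (\<Prod>j\<in>{1..h}. var (q j) :: ('v + 'w, 'k) cut_poly)"
    by (rule prod.cong[OF refl], subst s) simp_all
  moreover have "(\<Prod>j\<in>{h + 1..h + k}. var (part_prod (a j) (b j))) =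
      (\<Prod>j\<in>{1..k}. var (r j) :: ('v + 'w, 'k) cut_poly)"
    unfolding prod_split_shift by (rule prod.cong[OF refl], subst s) simp_all
  ultimately have "f = (\<Prod>j\<in>{1..h}. var (part_prod (a j) (b j))) -
      (\<Prod>j\<in>{h + 1..h + k}. var (part_prod (a j) (b j)))"
    by (simp only: f(1) q(2) r(2))
  then show ?thesis
    using ab assms(2) unfolding product_binomial_iff by blast
qed

text \<open>Adding the \<open>S c\<close> and \<open>T c\<close> coordinates of equal exponent sums
  gives \<open>h * d = k * d\<close> with \<open>d\<close> the nonzero total of
  \<open>c\<close>.\<close>

lemma product_binomial_homogeneous:
  fixes f :: "('v + 'w, 'k::field) cut_poly"
  assumes "label_total (disjoint_union G H) c \<noteq> 0" and "product_binomial G H h k f"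
  shows "h = k"
proof -
  obtain a b where ab: "\<forall>j\<in>{1..h + k}. a j \<in> ordered_partitions (verts G) \<and> b j \<in> ordered_partitions (verts H)"
    and "(\<Prod>j\<in>{1..h}. var (part_prod (a j) (b j))) - (\<Prod>j\<in>{h + 1..h + k}. var (part_prod (a j) (b j)))
      \<in> (cut_ideal (disjoint_union G H) :: ('v + 'w, 'k) cut_poly set)"
    using assms(2) unfolding product_binomial_iff by blast
  moreover have "part_prod (a j) (b j) \<in> partitions (verts (disjoint_union G H))" if "j \<in> {1..h} \<union> {h + 1..h + k}" for j
    using ab that unfolding interval_split by simp
  ultimately have eq: "(\<Sum>j\<in>{1..h}. cut_exponent (disjoint_union G H) (part_prod (a j) (b j))) =
      (\<Sum>j\<in>{h + 1..h + k}. cut_exponent (disjoint_union G H) (part_prod (a j) (b j)))"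
    using prod_binomial_in_cut_ideal[OF finite_edges_GUH, of "{1..h}" "{h + 1..h + k}"
        "\<lambda>j. part_prod (a j) (b j)", where 'k = 'k] by blast
  let ?t = "\<lambda>m. lookup m (S c) + lookup m (T c)"
  have total: "?t (\<Sum>j\<in>M. cut_exponent (disjoint_union G H) (part_prod (a j) (b j))) = int (card M) * label_total (disjoint_union G H) c" for M
    by (simp add: lookup_sum lookup_cut_exponent[OF finite_edges_GUH] flip: sum.distrib)
  have "int h * label_total (disjoint_union G H) c = int k * label_total (disjoint_union G H) c"
    using arg_cong[OF eq, of ?t] unfolding total by simp
  then show ?thesis using assms(1) by simp
qed

text \<open>A presentation with \<open>h = 0\<close> is \<open>1 - 1\<close>. To meet the bound
  \<open>h \<ge> 1\<close>, the zero binomial is rewritten as a variable minus itself.\<close>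

lemma product_binomial_zero: "product_binomial G H 1 1 (0 :: ('v + 'w, 'k::field) cut_poly)"
proof -
  have "(0 :: ('v + 'w, 'k) cut_poly) \<in> cut_ideal (disjoint_union G H)"
    by (simp add: cut_ideal_iff cut_map_def)
  then show ?thesis
    unfolding product_binomial_iff
    by (intro conjI exI[of _ "\<lambda>_. ({}, verts G)"] exI[of _ "\<lambda>_. ({}, verts H)"]) simp_all
qed

lemma homogeneous_binomial_iff:
  fixes f :: "('v + 'w, 'k::field) cut_poly"
  assumes "label_total (disjoint_union G H) c \<noteq> 0" and "f \<in> binomials (partitions (verts (disjoint_union G H)))"
  shows "f \<in> cut_ideal (disjoint_union G H) \<longleftrightarrow> swap_binomial G H f \<or> (\<exists>h\<ge>1. product_binomial G H h h f)"
proof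
  assume "f \<in> cut_ideal (disjoint_union G H)"
  then obtain h k where "product_binomial G H h k f"
    using binomial_imp_product_binomial assms(2) by blast
  moreover from this have "h = k" using product_binomial_homogeneous[OF assms(1)] by blast
  ultimately have hh: "product_binomial G H h h f" by simp
  show "swap_binomial G H f \<or> (\<exists>h\<ge>1. product_binomial G H h h f)"
  proof (cases "h = 0")
    case True
    then have "f = 0" using hh by (simp add: product_binomial_def)
    then show ?thesis using product_binomial_zero by auto
  next
    case False
    then have "h \<ge> 1" by simp
    then show ?thesis using hh by blast
  qed
next
  assume "swap_binomial G H f \<or> (\<exists>h\<ge>1. product_binomial G H h h f)"
  then show "f \<in> cut_ideal (disjoint_union G H)"
    using swap_binomial_in_cut_ideal product_binomial_iff by blast
qed

text \<open>Unequal \<open>h\<close> and \<open>k\<close> must be allowed: if all totals vanish, the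
  variable of the trivial partition minus \<open>1\<close> lies in the ideal, a case with
  \<open>h = 1\<close> and \<open>k = 0\<close>.\<close>

lemma binomial_iff:
  fixes f :: "('v + 'w, 'k::field) cut_poly"
  assumes "f \<in> binomials (partitions (verts (disjoint_union G H)))"
  shows "f \<in> cut_ideal (disjoint_union G H) \<longleftrightarrow> swap_binomial G H f \<or> (\<exists>h k. product_binomial G H h k f)"
  using binomial_imp_product_binomial[OF assms] swap_binomial_in_cut_ideal product_binomial_iff
  by blast

end

theorem theorem3p1:
  fixes V :: "'u set" and E :: "'u set set"
    and G :: "('v, 'l) lmgraph" and H :: "('w, 'm) lmgraph"
  assumes "simple_graph V E"
    and "labelled_multigraph G" and "labelled_multigraph H"
  shows
    "(\<forall>n\<ge>1. (Aff (isolated n) :: ('k::field, _) module) \<cong>\<^sub>a point) \<and>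

     (\<forall>\<sigma>. multiplicity_map E \<sigma> \<longrightarrow>
        (Aff (classical V E) :: ('k, _) module) \<cong>\<^sub>a Aff (canonical V E \<sigma>) \<and>
        (cut_ideal (classical V E) :: ('u, 'k) cut_poly set) = cut_ideal (canonical V E \<sigma>)) \<and>

     (\<forall>x\<in>verts G. \<forall>y\<in>verts H.
        (Aff (disjoint_union G H) :: ('k, _) module) \<cong>\<^sub>a Aff (zero_sum x y G H)) \<and>

     (\<forall>a\<in>ordered_partitions (verts G). \<forall>b\<in>ordered_partitions (verts H).
        (cut_map (disjoint_union G H) (var (part_prod a b)) :: ('l + 'm, 'k) laurent) =
          relabel Inl (cut_map G (var (unordered a))) *
          relabel Inr (cut_map H (var (unordered b)))) \<and>

     (\<forall>n\<ge>1.
        (Aff (disjoint_union G (isolated n)) :: ('k, _) module) \<cong>\<^sub>a Aff G \<and>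
        (\<forall>ord. (\<forall>p\<in>partitions (verts G).
                  ord p \<in> ordered_partitions (verts G) \<and> unordered (ord p) = p) \<longrightarrow>
          (let R = cut_ring (disjoint_union G (isolated n)) :: ('v + nat, 'k) cut_poly ring;
               I' = Idl\<^bsub>R\<^esub> (extend_vars ord (verts (isolated n)) ` cut_ideal G)
           in \<exists>L J. L \<subseteq> carrier R \<and> (\<forall>f\<in>L. linear_form f) \<and> J = Idl\<^bsub>R\<^esub> L \<and>
                cut_ideal (disjoint_union G (isolated n)) = I' <+>\<^bsub>R\<^esub> J))) \<and>

     ((\<exists>c\<in>labels (disjoint_union G H). label_total (disjoint_union G H) c \<noteq> 0) \<longrightarrow>
        (\<forall>f \<in> binomials (partitions (verts (disjoint_union G H))) :: ('v + 'w, 'k) cut_poly set.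
           f \<in> cut_ideal (disjoint_union G H) \<longleftrightarrow>
             swap_binomial G H f \<or> (\<exists>h\<ge>1. product_binomial G H h h f))) \<and>
     ((\<forall>c\<in>labels (disjoint_union G H). label_total (disjoint_union G H) c = 0) \<longrightarrow>
        (\<forall>f \<in> binomials (partitions (verts (disjoint_union G H))) :: ('v + 'w, 'k) cut_poly set.
           f \<in> cut_ideal (disjoint_union G H) \<longleftrightarrow>
             swap_binomial G H f \<or> (\<exists>h k. product_binomial G H h k f)))"
proof -
  have G: "simple_graph (verts G) (edges G)" and H: "simple_graph (verts H) (edges H)"
    using assms(2,3) by (simp_all add: labelled_multigraph_def)
  show ?thesis
    apply (intro conjI allI ballI impI)
    subgoal by (rule Aff_edgeless) simp
    subgoal by (rule Aff_canonical[OF assms(1)])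
    subgoal by (rule cut_ideal_canonical[OF assms(1)])
    subgoal by (rule Aff_zero_sum[OF G H])
    subgoal by (rule cut_map_disjoint_union[OF G H])
    subgoal by (rule Aff_union_isolated[OF G])
    subgoal for n ord
      unfolding Let_def
      by (rule cut_ideal_union_edgeless[OF G simple_graph_isolated isolated_simps(2)]) (assumption, erule bspec)
    subgoal by (elim bexE) (rule homogeneous_binomial_iff[OF G H])
    subgoal by (rule binomial_iff[OF G H])
    done
qed

end
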